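(* For every $k$, there is a (randomized, classical) $k$-local algorithm $\mathcal{A}$ for maximum cut such that for all $D$-regular $n$-vertex graphs $G$ with girth $g>2k+1$, the algorithm $\mathcal{A}$ on input $G$ outputs a cut $x\in\{\pm1\}^n$ cutting, in expectation over its randomness, at least a $$\frac{1}{\pi}\cos^{-1}\!\left(-\frac{2\sqrt{D-1}}{D}\right)-O\!\left(\frac{1}{\sqrt{k}}\right)\;>\;\frac12+\frac{2}{\pi\sqrt{D}}-O\!\left(\frac{1}{\sqrt{k}}\right)$$ fraction of the edges of $G$.
   Context: Graphs are finite, simple and undirected; girth is the length of a shortest cycle. For a cut $x\in\{\pm1\}^V$ of a graph $G=(V,E)$, the fraction of edges cut is $\Pr_{(i,j)\in E}[x_i\ne x_j]$ for a uniformly random edge $(i,j)$. Here $O(1/\sqrt{k})$ denotes a quantity bounded by an absolute constant (independent of $k$, $D$, $n$ and $G$) times $1/\sqrt{k}$, the same quantity on both sides of the displayed inequality. A randomized $k$-local classical algorithm for maximum cut is specified by a probability distribution $\mathcal{D}$ on some domain $S$ and a function $f$. On input a graph $G=(V,E)$, each vertex $v$ gets an independent random label $Y_v\sim\mathcal{D}$; the output is $X\in\{\pm1\}^V$ with $X_u=f(H_u)$ for each $u\in V$, where $H_u$ is the labeled graph obtained by taking the radius-$k$ ball around $u$ (rooted at $u$) and labeling each vertex $v$ in it with $Y_v$.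
   Formalization: The strict inequality between the two closed forms is asserted only for D ≥ 2, since at D = 1 it reads 1/2 > 1/2 + 2/π and is false; the cut guarantee is kept for D = 1. Also k ≥ 1, D ≥ 1 and n ≥ 1, so that 1/√k and the fraction of edges are defined. *)

theory Defs
  imports "HOL-Probability.Probability" "HOL-Library.Extended_Nat"
begin

definition simple_graph :: "'v set \<Rightarrow> 'v set set \<Rightarrow> bool" where
  "simple_graph V E \<longleftrightarrow> finite V \<and> (\<forall>e\<in>E. e \<subseteq> V \<and> card e = 2)"

definition regular :: "'v set \<Rightarrow> 'v set set \<Rightarrow> nat \<Rightarrow> bool" where
  "regular V E D \<longleftrightarrow> (\<forall>v\<in>V. card {e\<in>E. v \<in> e} = D)"

definition is_cycle :: "'v set set \<Rightarrow> 'v list \<Rightarrow> bool" where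
  "is_cycle E c \<longleftrightarrow> length c \<ge> 3 \<and> distinct c \<and>
     (\<forall>i<length c. {c ! i, c ! (Suc i mod length c)} \<in> E)"

text \<open>The girth of a forest is \<open>\<infinity>\<close>, the infimum of the empty set.\<close>

definition girth :: "'v set set \<Rightarrow> enat" where
  "girth E = (INF c \<in> {c. is_cycle E c}. enat (length c))"

definition graph_ball :: "'v set set \<Rightarrow> nat \<Rightarrow> 'v \<Rightarrow> 'v set" where
  "graph_ball E k u = {v. \<exists>i\<le>k. (u, v) \<in> {(x, y). {x, y} \<in> E} ^^ i}"

record ('v, 's) labeled_graph =
  verts :: "'v set"
  edges :: "'v set set"
  root :: 'v
  label :: "'v \<Rightarrow> 's"

text \<open>The labels range over the set \<open>S\<close> and are \<open>undefined\<close> off the vertex set.\<close>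

definition labeled_graphs :: "'s set \<Rightarrow> ('v, 's) labeled_graph set" where
  "labeled_graphs S = {H. simple_graph (verts H) (edges H) \<and> root H \<in> verts H \<and>
     label H \<in> verts H \<rightarrow>\<^sub>E S}"

definition isomorphic :: "('v, 's) labeled_graph \<Rightarrow> ('v, 's) labeled_graph \<Rightarrow> bool" where
  "isomorphic H H' \<longleftrightarrow> (\<exists>\<phi>. bij_betw \<phi> (verts H) (verts H') \<and>
     (\<lambda>e. \<phi> ` e) ` edges H = edges H' \<and> \<phi> (root H) = root H' \<and>
     (\<forall>v\<in>verts H. label H' (\<phi> v) = label H v))"

text \<open>The subgraph is the induced one. If the girth exceeds \<open>2 * k + 1\<close>, no edge joins two
  vertices at distance \<open>k\<close> from \<open>u\<close>, so keeping or dropping such edges makes no difference.\<close>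

definition local_view ::
  "nat \<Rightarrow> 'v set set \<Rightarrow> ('v \<Rightarrow> 's) \<Rightarrow> 'v \<Rightarrow> ('v, 's) labeled_graph" where
  "local_view k E Y u = (let B = graph_ball E k u in
     \<lparr>verts = B, edges = {e\<in>E. e \<subseteq> B}, root = u, label = restrict Y B\<rparr>)"

text \<open>The measure \<open>M\<close> is the distribution of a single label, with \<open>space M\<close> as its domain.
  Invariance under isomorphism says that the rule \<open>f\<close> cannot read vertex names: it is a function of
  the abstract rooted labeled graph. Measurability in the labels makes the output a random variable.\<close>

definition local_algorithm ::
  "'s measure \<Rightarrow> (('v, 's) labeled_graph \<Rightarrow> int) \<Rightarrow> bool" where
  "local_algorithm M f \<longleftrightarrow> prob_space M \<and>
     (\<forall>H\<in>labeled_graphs (space M). f H \<in> {-1, 1}) \<and>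
     (\<forall>H\<in>labeled_graphs (space M). \<forall>H'\<in>labeled_graphs (space M).
        isomorphic H H' \<longrightarrow> f H = f H') \<and>
     (\<forall>V E r. simple_graph V E \<and> r \<in> V \<longrightarrow>
        (\<lambda>Y. f \<lparr>verts = V, edges = E, root = r, label = Y\<rparr>)
          \<in> measurable (PiM V (\<lambda>_. M)) (count_space {-1, 1}))"

definition local_output ::
  "nat \<Rightarrow> (('v, 's) labeled_graph \<Rightarrow> int) \<Rightarrow> 'v set set \<Rightarrow> ('v \<Rightarrow> 's) \<Rightarrow> 'v \<Rightarrow> int" where
  "local_output k f E Y u = f (local_view k E Y u)"

definition cut_fraction :: "'v set set \<Rightarrow> ('v \<Rightarrow> int) \<Rightarrow> real" where
  "cut_fraction E x = measure_pmf.prob (pmf_of_set E) {e. \<exists>i j. e = {i, j} \<and> x i \<noteq> x j}"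

definition expected_cut_fraction ::
  "nat \<Rightarrow> 's measure \<Rightarrow> (('v, 's) labeled_graph \<Rightarrow> int) \<Rightarrow> 'v set \<Rightarrow> 'v set set \<Rightarrow> real" where
  "expected_cut_fraction k M f V E =
     (\<integral>Y. cut_fraction E (local_output k f E Y) \<partial>(PiM V (\<lambda>_. M)))"

end

theory Submission imports Defs begin

text \<open>Every vertex receives a standard normal label and outputs the sign of
  \<open>Z\<^sub>u = (\<Sum>v. (- 1 / sqrt (D - 1)) ^ dist u v * Y\<^sub>v)\<close>, the sum ranging over the ball of radius \<open>k\<close>
  around \<open>u\<close>. Large girth makes the balls trees, so the sphere sizes are known exactly, also on
  either side of an edge. Hence the fields at adjacent vertices have correlation
  \<open>- 2 * k * sqrt (D - 1) / (D - 1 + k * D)\<close>, within \<open>1 / k\<close> of \<open>- 2 * sqrt (D - 1) / D\<close>. Two jointly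
  normal variables of correlation \<open>\<rho>\<close> have different signs with probability \<open>arccos \<rho> / pi\<close>, and
  \<open>arccos\<close> is Hoelder continuous of exponent \<open>1 / 2\<close>.\<close>

section \<open>Linear forms in independent normal variables\<close>

text \<open>On a \<open>D\<close>-regular tree the sphere of radius \<open>i >= 1\<close> has
  \<open>D * (D - 1) ^ (i - 1)\<close> vertices. Weights of size \<open>(D - 1) ^ (- i / 2)\<close>
  therefore let every layer beyond the root contribute the same amount to the variance, and every
  pair of consecutive layers the same amount to the covariance across an edge; the alternating sign
  makes that covariance negative. Only the root layer, with variance \<open>1\<close> instead of
  \<open>D / (D - 1)\<close>, keeps the correlation away from its limit, hence the error of order
  \<open>1 / k\<close>. For \<open>D = 2\<close> the limit is \<open>-1\<close>, where
  \<open>arccos\<close> has infinite slope; a bound uniform in \<open>D\<close> obtained this way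
  loses \<open>1 / sqrt k\<close>. The rule must be fixed before \<open>D\<close> is known, so it
  reads the degree off the root of its view. The joint law of two fields comes from rotation
  invariance alone: labels are folded in one at a time while only two independent normal variables
  are kept. Nonnegative integrals avoid all integrability questions.\<close>

lemma nn_integral_shear_snd:
  fixes f :: "real \<times> real \<Rightarrow> ennreal"
  assumes [measurable]: "f \<in> borel_measurable (borel \<Otimes>\<^sub>M borel)"
  shows "(\<integral>\<^sup>+x. \<integral>\<^sup>+y. f (x, y + c * x) \<partial>lborel \<partial>lborel) = (\<integral>\<^sup>+x. \<integral>\<^sup>+y. f (x, y) \<partial>lborel \<partial>lborel)"
proof (rule nn_integral_cong)
  fix x :: real
  have "(\<integral>\<^sup>+y. f (x, y) \<partial>lborel) = (\<integral>\<^sup>+y. f (x, c * x + 1 * y) \<partial>lborel)"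
    by (subst nn_integral_real_affine[where c=1 and t="c*x"]) auto
  then show "(\<integral>\<^sup>+y. f (x, y + c * x) \<partial>lborel) = (\<integral>\<^sup>+y. f (x, y) \<partial>lborel)"
    by (simp add: add.commute)
qed

lemma nn_integral_shear_fst:
  fixes f :: "real \<times> real \<Rightarrow> ennreal"
  assumes [measurable]: "f \<in> borel_measurable (borel \<Otimes>\<^sub>M borel)"
  shows "(\<integral>\<^sup>+x. \<integral>\<^sup>+y. f (x + c * y, y) \<partial>lborel \<partial>lborel) = (\<integral>\<^sup>+x. \<integral>\<^sup>+y. f (x, y) \<partial>lborel \<partial>lborel)"
proof -
  have [measurable]: "(\<lambda>z. f (snd z, fst z)) \<in> borel_measurable (borel \<Otimes>\<^sub>M borel)"
    "(\<lambda>(x,y). f (x + c * y, y)) \<in> borel_measurable (lborel \<Otimes>\<^sub>M lborel)"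
    "(\<lambda>(x,y). f (x, y)) \<in> borel_measurable (lborel \<Otimes>\<^sub>M lborel)"
    by measurable
  show ?thesis
    using nn_integral_shear_snd[of "\<lambda>z. f (snd z, fst z)" c]
    by (subst (1 2) lborel_pair.Fubini'[symmetric]) simp_all
qed

text \<open>A rotation with \<open>s \<noteq> 0\<close> is a product of three shears.\<close>

lemma nn_integral_rotation:
  fixes f :: "real \<times> real \<Rightarrow> ennreal"
  assumes [measurable]: "f \<in> borel_measurable (borel \<Otimes>\<^sub>M borel)" and cs: "c\<^sup>2 + s\<^sup>2 = 1"
  shows "(\<integral>\<^sup>+x. \<integral>\<^sup>+y. f (c * x - s * y, s * x + c * y) \<partial>lborel \<partial>lborel) =
    (\<integral>\<^sup>+x. \<integral>\<^sup>+y. f (x, y) \<partial>lborel \<partial>lborel)"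
proof (cases "s = 0")
  case True
  with cs have "c\<^sup>2 = 1" by simp
  then consider "c = 1" | "c = -1"
    by (auto simp: power2_eq_1_iff)
  then show ?thesis
  proof cases
    case 2
    have refl: "(\<integral>\<^sup>+x. g (- x) \<partial>lborel) = (\<integral>\<^sup>+x. g x \<partial>lborel)"
      if "g \<in> borel_measurable borel" for g :: "real \<Rightarrow> ennreal"
      using nn_integral_real_affine[OF that, of "-1" 0] by simp
    have "(\<integral>\<^sup>+x. \<integral>\<^sup>+y. f (- x, - y) \<partial>lborel \<partial>lborel) = (\<integral>\<^sup>+x. \<integral>\<^sup>+y. f (- x, y) \<partial>lborel \<partial>lborel)"
      by (intro nn_integral_cong refl) measurable
    also have "\<dots> = (\<integral>\<^sup>+x. \<integral>\<^sup>+y. f (x, y) \<partial>lborel \<partial>lborel)"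
      by (rule refl) measurable
    finally show ?thesis using 2 True by simp
  qed (use True in simp)
next
  case False
  \<comment> \<open>For \<open>c\<close> and \<open>s\<close> the cosine and sine of an angle,
    \<open>u\<close> is minus the tangent of half the angle. The three shears have factors
    \<open>u\<close>, \<open>s\<close>, \<open>u\<close>.\<close>
  define u where "u = (c - 1) / s"
  have us: "u * s = c - 1" using False by (simp add: u_def)
  have u2: "u * (c + 1) = - s"
  proof -
    have "u * (c + 1) * s = - s * s"
    proof -
      have "u * (c + 1) * s = (u * s) * (c + 1)" by simp
      also have "\<dots> = c\<^sup>2 - 1" unfolding us by (simp add: power2_eq_square algebra_simps)
      also have "\<dots> = - s * s" using cs by (simp add: power2_eq_square)
      finally show ?thesis .
    qed
    then show ?thesis using False by (metis mult_right_cancel)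
  qed
  define f1 where "f1 z = f (fst z + u * snd z, snd z)" for z
  define f2 where "f2 z = f1 (fst z, snd z + s * fst z)" for z
  have [measurable]: "f1 \<in> borel_measurable (borel \<Otimes>\<^sub>M borel)" "f2 \<in> borel_measurable (borel \<Otimes>\<^sub>M borel)"
    unfolding f1_def f2_def by measurable
  have f2_rot: "f2 (x + u * y, y) = f (c * x - s * y, s * x + c * y)" for x y
  proof -
    have "x + u * y + u * (y + s * (x + u * y)) = (1 + u * s) * x + (u * ((1 + u * s) + 1)) * y"
      by (simp add: algebra_simps)
    also have "\<dots> = c * x - s * y" using us u2 by simp
    finally have 1: "x + u * y + u * (y + s * (x + u * y)) = c * x - s * y" .
    have "y + s * (x + u * y) = s * x + (1 + u * s) * y" by (simp add: algebra_simps)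
    also have "\<dots> = s * x + c * y" using us by simp
    finally show ?thesis using 1 by (simp add: f1_def f2_def)
  qed
  have "(\<integral>\<^sup>+x. \<integral>\<^sup>+y. f (x, y) \<partial>lborel \<partial>lborel) = (\<integral>\<^sup>+x. \<integral>\<^sup>+y. f1 (x, y) \<partial>lborel \<partial>lborel)"
    using nn_integral_shear_fst[of f u] by (simp add: f1_def)
  also have "\<dots> = (\<integral>\<^sup>+x. \<integral>\<^sup>+y. f2 (x, y) \<partial>lborel \<partial>lborel)"
    using nn_integral_shear_snd[of f1 s] by (simp add: f2_def)
  also have "\<dots> = (\<integral>\<^sup>+x. \<integral>\<^sup>+y. f2 (x + u * y, y) \<partial>lborel \<partial>lborel)"
    by (simp add: nn_integral_shear_fst)
  finally show ?thesis by (simp add: f2_rot)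
qed

section \<open>The standard normal measure and its rotation invariance\<close>

definition gaussian :: "real measure" where
  "gaussian = density lborel std_normal_density"

lemma sets_gaussian[measurable_cong, simp]: "sets gaussian = sets borel"
  and space_gaussian[simp]: "space gaussian = UNIV"
  by (simp_all add: gaussian_def)

interpretation gaussian: prob_space gaussian
  unfolding gaussian_def by (rule prob_space_normal_density) simp

interpretation gaussian_pair: pair_sigma_finite gaussian gaussian ..

lemma gaussian_product_nn_integral:
  fixes f :: "real \<times> real \<Rightarrow> ennreal"
  assumes [measurable]: "f \<in> borel_measurable (borel \<Otimes>\<^sub>M borel)"
  shows "(\<integral>\<^sup>+x. \<integral>\<^sup>+y. f (x, y) \<partial>gaussian \<partial>gaussian) =
    (\<integral>\<^sup>+x. \<integral>\<^sup>+y. ennreal (exp (- (x\<^sup>2 + y\<^sup>2) / 2) / (2 * pi)) * f (x, y) \<partial>lborel \<partial>lborel)"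
proof -
  have dens: "ennreal (std_normal_density x) * (ennreal (std_normal_density y) * z)
      = ennreal (exp (- (x\<^sup>2 + y\<^sup>2) / 2) / (2 * pi)) * z" for x y z
  proof -
    have "std_normal_density x * std_normal_density y = exp (- (x\<^sup>2 + y\<^sup>2) / 2) / (2 * pi)"
      by (simp add: normal_density_def exp_add[symmetric] add_divide_distrib real_sqrt_mult[symmetric] diff_divide_distrib)
    then show ?thesis
      by (simp add: ennreal_mult' [symmetric] mult.assoc[symmetric])
  qed
  have "(\<integral>\<^sup>+x. \<integral>\<^sup>+y. f (x, y) \<partial>gaussian \<partial>gaussian) =
      (\<integral>\<^sup>+x. ennreal (std_normal_density x) * (\<integral>\<^sup>+y. ennreal (std_normal_density y) * f (x, y) \<partial>lborel) \<partial>lborel)"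
    unfolding gaussian_def
    by (subst nn_integral_density; simp add: nn_integral_density)
  also have "\<dots> = (\<integral>\<^sup>+x. \<integral>\<^sup>+y. ennreal (std_normal_density x) * (ennreal (std_normal_density y) * f (x, y)) \<partial>lborel \<partial>lborel)"
    by (intro nn_integral_cong nn_integral_cmult[symmetric]) measurable
  finally show ?thesis by (simp only: dens)
qed

text \<open>The joint density depends only on \<open>x\<^sup>2 + y\<^sup>2\<close>, so invariance
  passes from Lebesgue measure to the normal measure.\<close>

lemma gaussian_rotation:
  fixes f :: "real \<times> real \<Rightarrow> ennreal"
  assumes [measurable]: "f \<in> borel_measurable (borel \<Otimes>\<^sub>M borel)" and cs: "c\<^sup>2 + s\<^sup>2 = 1"
  shows "(\<integral>\<^sup>+x. \<integral>\<^sup>+y. f (c * x - s * y, s * x + c * y) \<partial>gaussian \<partial>gaussian) =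
    (\<integral>\<^sup>+x. \<integral>\<^sup>+y. f (x, y) \<partial>gaussian \<partial>gaussian)"
proof -
  define g where "g z = ennreal (exp (- ((fst z)\<^sup>2 + (snd z)\<^sup>2) / 2) / (2 * pi)) * f z" for z :: "real \<times> real"
  have [measurable]: "g \<in> borel_measurable (borel \<Otimes>\<^sub>M borel)" unfolding g_def by measurable
  have [measurable]: "(\<lambda>z. f (c * fst z - s * snd z, s * fst z + c * snd z)) \<in> borel_measurable (borel \<Otimes>\<^sub>M borel)"
    by measurable
  have inv: "(c * x - s * y)\<^sup>2 + (s * x + c * y)\<^sup>2 = x\<^sup>2 + y\<^sup>2" for x y
  proof -
    have "(c * x - s * y)\<^sup>2 + (s * x + c * y)\<^sup>2 = (c\<^sup>2 + s\<^sup>2) * x\<^sup>2 + (c\<^sup>2 + s\<^sup>2) * y\<^sup>2"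
      by (simp add: power2_eq_square algebra_simps)
    then show ?thesis using cs by simp
  qed
  show ?thesis
    using nn_integral_rotation[OF \<open>g \<in> _\<close> cs]
      gaussian_product_nn_integral[of f]
      gaussian_product_nn_integral[of "\<lambda>z. f (c * fst z - s * snd z, s * fst z + c * snd z)"]
    by (simp add: g_def inv)
qed

text \<open>One step of a QR decomposition: a rotation makes the first form depend on one variable
  only and preserves the inner products of the coefficient vectors \<open>(p, a)\<close> and
  \<open>(q, b)\<close>.\<close>

lemma gaussian_reduce:
  fixes p a q b :: real
  shows "\<exists>p' q' s'. p'\<^sup>2 = p\<^sup>2 + a\<^sup>2 \<and> p' * q' = p * q + a * b \<and> q'\<^sup>2 + s'\<^sup>2 = q\<^sup>2 + b\<^sup>2 \<and>
    (\<forall>g :: real \<times> real \<Rightarrow> ennreal. g \<in> borel_measurable (borel \<Otimes>\<^sub>M borel) \<longrightarrow>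
      (\<integral>\<^sup>+x. \<integral>\<^sup>+w. g (p * x + a * w, q * x + b * w) \<partial>gaussian \<partial>gaussian) =
      (\<integral>\<^sup>+x. \<integral>\<^sup>+w. g (p' * x, q' * x + s' * w) \<partial>gaussian \<partial>gaussian))"
proof (cases "p = 0 \<and> a = 0")
  case True
  show ?thesis
    by (rule exI[of _ 0], rule exI[of _ q], rule exI[of _ b]) (simp add: True)
next
  case False
  define p' where "p' = sqrt (p\<^sup>2 + a\<^sup>2)"
  have p'2: "p'\<^sup>2 = p\<^sup>2 + a\<^sup>2" by (simp add: p'_def)
  have "p' \<noteq> 0" using False by (simp add: p'_def sum_power2_eq_zero_iff)
  \<comment> \<open>The rotation that turns \<open>(p, a)\<close> into \<open>(p', 0)\<close>; the
    same rotation turns \<open>(q, b)\<close> into \<open>(q', s')\<close>.\<close>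
  define c where "c = p / p'"
  define s where "s = - a / p'"
  have pc: "p' * c = p" "p' * s = - a" using \<open>p' \<noteq> 0\<close> by (simp_all add: c_def s_def)
  have cs: "c\<^sup>2 + s\<^sup>2 = 1"
    using \<open>p' \<noteq> 0\<close> p'2 by (simp add: c_def s_def power_divide flip: add_divide_distrib p'2)
  define q' where "q' = q * c - b * s"
  define s' where "s' = q * s + b * c"
  have qc: "q' * c + s' * s = q"
  proof -
    have "q' * c + s' * s = q * (c\<^sup>2 + s\<^sup>2)" by (simp add: q'_def s'_def algebra_simps power2_eq_square)
    then show ?thesis using cs by simp
  qed
  have bc: "s' * c - q' * s = b"
  proof -
    have "s' * c - q' * s = b * (c\<^sup>2 + s\<^sup>2)" by (simp add: q'_def s'_def algebra_simps power2_eq_square)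
    then show ?thesis using cs by simp
  qed
  show ?thesis
  proof (rule exI[of _ p'], rule exI[of _ q'], rule exI[of _ s'], intro conjI allI impI)
    show "p'\<^sup>2 = p\<^sup>2 + a\<^sup>2" by (fact p'2)
    have "p' * q' = q * (p' * c) - b * (p' * s)" by (simp add: q'_def algebra_simps)
    then show "p' * q' = p * q + a * b" by (simp add: pc)
    have "q'\<^sup>2 + s'\<^sup>2 = (q\<^sup>2 + b\<^sup>2) * (c\<^sup>2 + s\<^sup>2)" by (simp add: q'_def s'_def algebra_simps power2_eq_square)
    then show "q'\<^sup>2 + s'\<^sup>2 = q\<^sup>2 + b\<^sup>2" using cs by simp
    fix g :: "real \<times> real \<Rightarrow> ennreal" assume [measurable]: "g \<in> borel_measurable (borel \<Otimes>\<^sub>M borel)"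
    have eq: "p' * (c * x - s * y) = p * x + a * y"
      "q' * (c * x - s * y) + s' * (s * x + c * y) = q * x + b * y" for x y
    proof -
      have "p' * (c * x - s * y) = (p' * c) * x - (p' * s) * y" by (simp add: algebra_simps)
      then show "p' * (c * x - s * y) = p * x + a * y" by (simp add: pc)
      have "q' * (c * x - s * y) + s' * (s * x + c * y) = (q' * c + s' * s) * x + (s' * c - q' * s) * y"
        by (simp add: algebra_simps)
      then show "q' * (c * x - s * y) + s' * (s * x + c * y) = q * x + b * y" by (simp add: qc bc)
    qed
    show "(\<integral>\<^sup>+x. \<integral>\<^sup>+w. g (p * x + a * w, q * x + b * w) \<partial>gaussian \<partial>gaussian) =
      (\<integral>\<^sup>+x. \<integral>\<^sup>+w. g (p' * x, q' * x + s' * w) \<partial>gaussian \<partial>gaussian)"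
      using gaussian_rotation[OF _ cs, of "\<lambda>z. g (p' * fst z, q' * fst z + s' * snd z)"]
      by (simp add: eq)
  qed
qed

text \<open>The joint law of two linear forms is determined by their covariance matrix;
  \<open>p\<close>, \<open>q\<close>, \<open>r\<close> are the entries of a triangular factor of it.
  The induction folds in one label at a time.\<close>

lemma gaussian_linear_forms:
  fixes a b :: "'i \<Rightarrow> real"
  assumes "finite I"
  shows "\<exists>p q r. p\<^sup>2 = (\<Sum>i\<in>I. (a i)\<^sup>2) \<and> p * q = (\<Sum>i\<in>I. a i * b i) \<and> q\<^sup>2 + r\<^sup>2 = (\<Sum>i\<in>I. (b i)\<^sup>2) \<and>
    (\<forall>h :: real \<times> real \<Rightarrow> ennreal. h \<in> borel_measurable (borel \<Otimes>\<^sub>M borel) \<longrightarrow>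
      (\<integral>\<^sup>+Y. h (\<Sum>i\<in>I. a i * Y i, \<Sum>i\<in>I. b i * Y i) \<partial>(PiM I (\<lambda>_. gaussian))) =
      (\<integral>\<^sup>+x. \<integral>\<^sup>+y. h (p * x, q * x + r * y) \<partial>gaussian \<partial>gaussian))"
  using assms
proof (induction I rule: finite_induct)
  case empty
  show ?case
    by (intro exI[of _ 0]) (auto simp: PiM_empty gaussian.emeasure_space_1[simplified] nn_integral_count_space_finite)
next
  case (insert i I)
  interpret P: product_sigma_finite "\<lambda>_. gaussian" ..
  obtain p q r where pqr: "p\<^sup>2 = (\<Sum>i\<in>I. (a i)\<^sup>2)" "p * q = (\<Sum>i\<in>I. a i * b i)" "q\<^sup>2 + r\<^sup>2 = (\<Sum>i\<in>I. (b i)\<^sup>2)"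
    and IH: "\<forall>h :: real \<times> real \<Rightarrow> ennreal. h \<in> borel_measurable (borel \<Otimes>\<^sub>M borel) \<longrightarrow>
      (\<integral>\<^sup>+Y. h (\<Sum>i\<in>I. a i * Y i, \<Sum>i\<in>I. b i * Y i) \<partial>(PiM I (\<lambda>_. gaussian))) =
      (\<integral>\<^sup>+x. \<integral>\<^sup>+y. h (p * x, q * x + r * y) \<partial>gaussian \<partial>gaussian)"
    using insert.IH by (elim exE conjE)
  \<comment> \<open>The new label \<open>w\<close> joins \<open>x\<close> and \<open>y\<close>.
    Rotating the plane of \<open>x\<close> and \<open>w\<close> removes \<open>w\<close> from the
    first form.\<close>
  obtain p' q' s' where 1: "p'\<^sup>2 = p\<^sup>2 + (a i)\<^sup>2" "p' * q' = p * q + a i * b i" "q'\<^sup>2 + s'\<^sup>2 = q\<^sup>2 + (b i)\<^sup>2"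
    "\<forall>g :: real \<times> real \<Rightarrow> ennreal. g \<in> borel_measurable (borel \<Otimes>\<^sub>M borel) \<longrightarrow>
      (\<integral>\<^sup>+x. \<integral>\<^sup>+w. g (p * x + a i * w, q * x + b i * w) \<partial>gaussian \<partial>gaussian) =
      (\<integral>\<^sup>+x. \<integral>\<^sup>+w. g (p' * x, q' * x + s' * w) \<partial>gaussian \<partial>gaussian)"
    using gaussian_reduce[of p "a i" q "b i"] by (elim exE conjE)
  \<comment> \<open>The second form still holds two independent variables besides \<open>x\<close>,
    with coefficients \<open>s'\<close> and \<open>r\<close>. They merge into one of coefficient
    \<open>r'\<close>; the zero form serves as the partner.\<close>
  obtain r' q1 s1 where 2: "r'\<^sup>2 = s'\<^sup>2 + r\<^sup>2"
    "\<forall>g :: real \<times> real \<Rightarrow> ennreal. g \<in> borel_measurable (borel \<Otimes>\<^sub>M borel) \<longrightarrow>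
      (\<integral>\<^sup>+x. \<integral>\<^sup>+w. g (s' * x + r * w, 0 * x + 0 * w) \<partial>gaussian \<partial>gaussian) =
      (\<integral>\<^sup>+x. \<integral>\<^sup>+w. g (r' * x, q1 * x + s1 * w) \<partial>gaussian \<partial>gaussian)"
    using gaussian_reduce[of s' r 0 0] by (elim exE conjE)
  show ?case
  proof (intro exI conjI allI impI)
    show "p'\<^sup>2 = (\<Sum>i\<in>insert i I. (a i)\<^sup>2)" "p' * q' = (\<Sum>i\<in>insert i I. a i * b i)"
      "q'\<^sup>2 + r'\<^sup>2 = (\<Sum>i\<in>insert i I. (b i)\<^sup>2)"
      using 1 2 pqr insert.hyps by auto
    fix h :: "real \<times> real \<Rightarrow> ennreal"
    assume [measurable]: "h \<in> borel_measurable (borel \<Otimes>\<^sub>M borel)"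
    define h' where "h' z = (\<integral>\<^sup>+w. h (fst z + a i * w, snd z + b i * w) \<partial>gaussian)" for z
    have [measurable]: "h' \<in> borel_measurable (borel \<Otimes>\<^sub>M borel)"
      unfolding h'_def by measurable
    define g where "g z = (\<integral>\<^sup>+y. h (fst z, snd z + r * y) \<partial>gaussian)" for z
    have [measurable]: "g \<in> borel_measurable (borel \<Otimes>\<^sub>M borel)"
      unfolding g_def by measurable
    have sumI: "(\<Sum>j\<in>I. c j * (Y(i := w)) j) = (\<Sum>j\<in>I. c j * Y j)" for c Y w
      using insert.hyps by (intro sum.cong) auto
    have "(\<integral>\<^sup>+Y. h (\<Sum>i\<in>insert i I. a i * Y i, \<Sum>i\<in>insert i I. b i * Y i) \<partial>(PiM (insert i I) (\<lambda>_. gaussian)))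
      = (\<integral>\<^sup>+Y. h' (\<Sum>i\<in>I. a i * Y i, \<Sum>i\<in>I. b i * Y i) \<partial>(PiM I (\<lambda>_. gaussian)))"
      using insert.hyps
      by (subst P.product_nn_integral_insert) (simp_all add: sumI h'_def add.commute del: fun_upd_apply, simp add: fun_upd_apply)
    also have "\<dots> = (\<integral>\<^sup>+x. \<integral>\<^sup>+y. h' (p * x, q * x + r * y) \<partial>gaussian \<partial>gaussian)"
      by (rule IH[rule_format]) measurable
    also have "\<dots> = (\<integral>\<^sup>+x. \<integral>\<^sup>+w. g (p * x + a i * w, q * x + b i * w) \<partial>gaussian \<partial>gaussian)"
    proof (rule nn_integral_cong)
      fix x
      show "(\<integral>\<^sup>+y. h' (p * x, q * x + r * y) \<partial>gaussian) = (\<integral>\<^sup>+w. g (p * x + a i * w, q * x + b i * w) \<partial>gaussian)"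
        using gaussian_pair.Fubini'[of "\<lambda>y w. h (p * x + a i * w, q * x + r * y + b i * w)"]
        by (simp add: h'_def g_def add_ac)
    qed
    also have "\<dots> = (\<integral>\<^sup>+x. \<integral>\<^sup>+w. g (p' * x, q' * x + s' * w) \<partial>gaussian \<partial>gaussian)"
      by (rule 1(4)[rule_format]) measurable
    also have "\<dots> = (\<integral>\<^sup>+x. \<integral>\<^sup>+w. h (p' * x, q' * x + r' * w) \<partial>gaussian \<partial>gaussian)"
    proof (rule nn_integral_cong)
      fix x
      show "(\<integral>\<^sup>+w. g (p' * x, q' * x + s' * w) \<partial>gaussian) = (\<integral>\<^sup>+w. h (p' * x, q' * x + r' * w) \<partial>gaussian)"
        using 2(2)[rule_format, of "\<lambda>z. h (p' * x, q' * x + fst z)"]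
        by (simp add: g_def add_ac gaussian.emeasure_space_1[simplified])
    qed
    finally show "(\<integral>\<^sup>+Y. h (\<Sum>i\<in>insert i I. a i * Y i, \<Sum>i\<in>insert i I. b i * Y i) \<partial>(PiM (insert i I) (\<lambda>_. gaussian)))
      = (\<integral>\<^sup>+x. \<integral>\<^sup>+y. h (p' * x, q' * x + r' * y) \<partial>gaussian \<partial>gaussian)" .
  qed
qed

text \<open>The factor \<open>\<bar>y\<bar>\<close> is the Jacobian of the substitution used for the
  quotient law below. It gives each half-line an elementary antiderivative, and the two halves are
  equal.\<close>

lemma nn_integral_radial_gaussian:
  fixes s :: real
  shows "(\<integral>\<^sup>+y. ennreal (\<bar>y\<bar> * exp (- ((1 + s\<^sup>2) * y\<^sup>2) / 2)) \<partial>lborel) = ennreal (2 / (1 + s\<^sup>2))"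
proof -
  define A where "A = 1 + s\<^sup>2"
  have A: "A > 0" by (simp add: A_def add_pos_nonneg)
  define f where "f y = y * exp (- (A * y\<^sup>2) / 2)" for y :: real
  have half: "(\<integral>\<^sup>+y. ennreal (f y) * indicator {0..} y \<partial>lborel) = ennreal (1 / A)"
  proof -
    have lim: "((\<lambda>y. - exp (- (A * y\<^sup>2) / 2) / A) \<longlongrightarrow> 0) at_top"
      using A by real_asymp
    have "(\<integral>\<^sup>+y. ennreal (f y) * indicator {0..} y \<partial>lborel) = ennreal (0 - (- exp (- (A * 0\<^sup>2) / 2) / A))"
      by (rule nn_integral_FTC_atLeast[OF _ _ _ lim])
        (use A in \<open>auto simp: f_def intro!: derivative_eq_intros\<close>)
    then show ?thesis by simp
  qed
  have half': "(\<integral>\<^sup>+y. ennreal (f (- y)) * indicator {..0} y \<partial>lborel) = ennreal (1 / A)"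
    unfolding half[symmetric]
    by (subst (2) nn_integral_real_affine[where c="-1" and t=0]) (auto simp: f_def indicator_def intro!: nn_integral_cong)
  have "(\<integral>\<^sup>+y. ennreal (\<bar>y\<bar> * exp (- (A * y\<^sup>2) / 2)) \<partial>lborel) =
    (\<integral>\<^sup>+y. ennreal (f y) * indicator {0..} y + ennreal (f (- y)) * indicator {..0} y \<partial>lborel)"
    by (intro nn_integral_cong) (auto simp: f_def indicator_def)
  also have "\<dots> = ennreal (1 / A) + ennreal (1 / A)"
    by (subst nn_integral_add) (auto simp: half half', auto simp: f_def indicator_def)
  also have "\<dots> = ennreal (2 / A)" using A by (simp flip: ennreal_plus)
  finally show ?thesis by (simp add: A_def)
qed

text \<open>The quotient of two independent standard normal variables has the Cauchy distribution:
  substituting \<open>x = s * y\<close> leaves the density \<open>1 / (pi * (1 + s\<^sup>2))\<close>.\<close>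

lemma gaussian_cone:
  fixes t :: real
  assumes "t \<ge> 0"
  shows "(\<integral>\<^sup>+x. \<integral>\<^sup>+y. indicator {z. \<bar>fst z\<bar> < t * \<bar>snd z\<bar>} (x, y) \<partial>gaussian \<partial>gaussian) =
    ennreal (2 / pi * arctan t)"
proof -
  define e where "e x y = ennreal (exp (- (x\<^sup>2 + y\<^sup>2) / 2) / (2 * pi))" for x y :: real
  define i :: "real \<times> real \<Rightarrow> ennreal" where "i = indicator {z. \<bar>fst z\<bar> < t * \<bar>snd z\<bar>}"
  have [measurable]: "i \<in> borel_measurable (borel \<Otimes>\<^sub>M borel)" unfolding i_def by measurable
  have [measurable]: "(\<lambda>z. e (f z) (g z)) \<in> borel_measurable M"
    if "f \<in> borel_measurable M" "g \<in> borel_measurable M" for f g and M :: "'z measure"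
    unfolding e_def using that by measurable
  have "(\<integral>\<^sup>+x. \<integral>\<^sup>+y. i (x, y) \<partial>gaussian \<partial>gaussian) = (\<integral>\<^sup>+x. \<integral>\<^sup>+y. e x y * i (x, y) \<partial>lborel \<partial>lborel)"
    by (subst gaussian_product_nn_integral) (simp_all add: e_def)
  also have "\<dots> = (\<integral>\<^sup>+y. \<integral>\<^sup>+x. e x y * i (x, y) \<partial>lborel \<partial>lborel)"
    by (rule lborel_pair.Fubini') measurable
  also have "\<dots> = (\<integral>\<^sup>+y. \<integral>\<^sup>+s. ennreal \<bar>y\<bar> * e (s * y) y * indicator {-t<..<t} s \<partial>lborel \<partial>lborel)"
  proof (rule nn_integral_cong_AE, rule AE_mp[OF AE_lborel_singleton[of 0]], intro AE_I2 impI)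
    fix y :: real assume "y \<noteq> 0"
    have "i (y * s, y) = indicator {-t<..<t} s" for s
      using \<open>y \<noteq> 0\<close> by (auto simp: i_def indicator_def abs_mult mult.commute)
    then show "(\<integral>\<^sup>+x. e x y * i (x, y) \<partial>lborel) = (\<integral>\<^sup>+s. ennreal \<bar>y\<bar> * e (s * y) y * indicator {-t<..<t} s \<partial>lborel)"
      using \<open>y \<noteq> 0\<close>
      by (subst nn_integral_real_affine[where c=y and t=0])
        (auto simp: nn_integral_cmult[symmetric] mult.commute mult.left_commute)
  qed
  also have "\<dots> = (\<integral>\<^sup>+s. \<integral>\<^sup>+y. ennreal \<bar>y\<bar> * e (s * y) y * indicator {-t<..<t} s \<partial>lborel \<partial>lborel)"
    by (rule lborel_pair.Fubini'[symmetric]) measurable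
  also have "\<dots> = (\<integral>\<^sup>+s. ennreal (1 / (pi * (1 + s\<^sup>2))) * indicator {-t..t} s \<partial>lborel)"
  \<comment> \<open>Removing the null set of the two endpoints replaces the open interval by the
    closed one that the fundamental theorem needs.\<close>
  proof (rule nn_integral_cong_AE, rule AE_mp[OF AE_lborel_singleton[of t]],
      rule AE_mp[OF AE_lborel_singleton[of "-t"]], intro AE_I2 impI)
    fix s :: real assume "s \<noteq> t" "s \<noteq> -t"
    have pos: "1 + s\<^sup>2 > 0" by (simp add: add_pos_nonneg)
    have "ennreal \<bar>y\<bar> * e (s * y) y = ennreal (1 / (2 * pi)) * ennreal (\<bar>y\<bar> * exp (- ((1 + s\<^sup>2) * y\<^sup>2) / 2))" for y
      by (simp add: e_def algebra_simps power_mult_distrib flip: ennreal_mult)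
    then have "(\<integral>\<^sup>+y. ennreal \<bar>y\<bar> * e (s * y) y \<partial>lborel) =
        (\<integral>\<^sup>+y. ennreal (1 / (2 * pi)) * ennreal (\<bar>y\<bar> * exp (- ((1 + s\<^sup>2) * y\<^sup>2) / 2)) \<partial>lborel)"
      by (simp only:)
    also have "\<dots> = ennreal (1 / (2 * pi)) * ennreal (2 / (1 + s\<^sup>2))"
      by (subst nn_integral_cmult) (measurable, simp only: nn_integral_radial_gaussian)
    also have "\<dots> = ennreal (1 / (pi * (1 + s\<^sup>2)))"
      using pos by (simp flip: ennreal_mult)
    finally have "(\<integral>\<^sup>+y. ennreal \<bar>y\<bar> * e (s * y) y \<partial>lborel) = ennreal (1 / (pi * (1 + s\<^sup>2)))" .
    then show "(\<integral>\<^sup>+y. ennreal \<bar>y\<bar> * e (s * y) y * indicator {-t<..<t} s \<partial>lborel)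
      = ennreal (1 / (pi * (1 + s\<^sup>2))) * indicator {-t..t} s"
      using \<open>s \<noteq> t\<close> \<open>s \<noteq> -t\<close> by (auto simp: nn_integral_multc indicator_def)
  qed
  also have "\<dots> = ennreal (arctan t / pi - arctan (- t) / pi)"
  proof (rule nn_integral_FTC_Icc)
    fix s :: real
    have "((\<lambda>s. arctan s / pi) has_real_derivative inverse (1 + s\<^sup>2) / pi) (at s)"
      by (intro DERIV_cdivide DERIV_arctan)
    then show "((\<lambda>s. arctan s / pi) has_real_derivative 1 / (pi * (1 + s\<^sup>2))) (at s)"
      by (simp add: divide_inverse mult.commute)
  qed (use assms in \<open>auto simp: add_pos_nonneg\<close>)
  finally show ?thesis by (simp add: i_def arctan_minus)
qed

text \<open>The forms with coefficients \<open>a + b\<close> and \<open>a - b\<close> are uncorrelated, hence independent, and the signs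
  differ when the first is smaller in absolute value than the second.\<close>

lemma gaussian_sign_disagreement:
  fixes a b :: "'i \<Rightarrow> real"
  assumes "finite I" and v: "(\<Sum>i\<in>I. (a i)\<^sup>2) = v" "(\<Sum>i\<in>I. (b i)\<^sup>2) = v" "v > 0"
    and phi: "(\<Sum>i\<in>I. a i * b i) = v * cos \<phi>" "0 \<le> \<phi>" "\<phi> < pi"
  shows "\<phi> / pi \<le> measure (PiM I (\<lambda>_. gaussian))
    {Y \<in> space (PiM I (\<lambda>_. gaussian)). ((\<Sum>i\<in>I. a i * Y i) > 0) \<noteq> ((\<Sum>i\<in>I. b i * Y i) > 0)}"
    (is "_ \<le> measure ?P ?A")
proof -
  interpret P: prob_space ?P by (intro prob_space_PiM gaussian.prob_space_axioms)
  obtain p q r where p: "p\<^sup>2 = (\<Sum>i\<in>I. (a i + b i)\<^sup>2)" and pq: "p * q = (\<Sum>i\<in>I. (a i + b i) * (a i - b i))"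
    and r: "q\<^sup>2 + r\<^sup>2 = (\<Sum>i\<in>I. (a i - b i)\<^sup>2)"
    and law: "\<forall>h :: real \<times> real \<Rightarrow> ennreal. h \<in> borel_measurable (borel \<Otimes>\<^sub>M borel) \<longrightarrow>
      (\<integral>\<^sup>+Y. h (\<Sum>i\<in>I. (a i + b i) * Y i, \<Sum>i\<in>I. (a i - b i) * Y i) \<partial>?P) =
      (\<integral>\<^sup>+x. \<integral>\<^sup>+y. h (p * x, q * x + r * y) \<partial>gaussian \<partial>gaussian)"
    using gaussian_linear_forms[OF \<open>finite I\<close>, of "\<lambda>i. a i + b i" "\<lambda>i. a i - b i"] by (elim exE conjE)
  \<comment> \<open>Half angles turn the variances of sum and difference into \<open>4 * v\<close>
    times the squared cosine and sine of \<open>\<phi> / 2\<close>, so the standard deviations have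
    ratio \<open>tan (\<phi> / 2)\<close>, the slope of the cone.\<close>
  have cos_half: "cos \<phi> = 2 * (cos (\<phi> / 2))\<^sup>2 - 1" and sin_half: "cos \<phi> = 1 - 2 * (sin (\<phi> / 2))\<^sup>2"
    using cos_double_cos[of "\<phi> / 2"] cos_double_sin[of "\<phi> / 2"] by simp_all
  have "p\<^sup>2 = v + v + 2 * (v * cos \<phi>)"
    unfolding p by (simp add: power2_sum sum.distrib v phi(1) mult.assoc flip: sum_distrib_left)
  also have "\<dots> = 4 * v * (cos (\<phi> / 2))\<^sup>2"
    unfolding cos_half by (simp add: algebra_simps)
  finally have p2: "p\<^sup>2 = 4 * v * (cos (\<phi> / 2))\<^sup>2" .
  have "q\<^sup>2 + r\<^sup>2 = v + v - 2 * (v * cos \<phi>)"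
    unfolding r by (simp add: power2_diff sum.distrib sum_subtractf v phi(1) mult.assoc flip: sum_distrib_left)
  also have "\<dots> = 4 * v * (sin (\<phi> / 2))\<^sup>2"
    unfolding sin_half by (simp add: algebra_simps)
  finally have r2: "q\<^sup>2 + r\<^sup>2 = 4 * v * (sin (\<phi> / 2))\<^sup>2" .
  have "p * q = 0"
    unfolding pq by (simp add: algebra_simps sum.distrib sum_subtractf v flip: power2_eq_square)
  have c: "cos (\<phi> / 2) > 0" using phi by (intro cos_gt_zero_pi) auto
  have s: "sin (\<phi> / 2) \<ge> 0" using phi by (intro sin_ge_zero) auto
  \<comment> \<open>This is where \<open>\<phi> < pi\<close> enters: the sum must not be degenerate.
    Equal variances give \<open>p * q = 0\<close>, so \<open>q = 0\<close> makes the two forms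
    independent.\<close>
  have "p \<noteq> 0" using p2 c v by auto
  with \<open>p * q = 0\<close> have "q = 0" by simp
  define t where "t = tan (\<phi> / 2)"
  have "t \<ge> 0" using c s by (simp add: t_def tan_def)
  have "(\<bar>p\<bar> * t)\<^sup>2 = \<bar>r\<bar>\<^sup>2"
    using r2 p2 c \<open>q = 0\<close> by (simp add: power_mult_distrib t_def tan_def power_divide)
  then have rt: "\<bar>r\<bar> = \<bar>p\<bar> * t"
    using \<open>t \<ge> 0\<close> by (subst (asm) power2_eq_iff_nonneg) auto
  define C where "C = {z :: real \<times> real. \<bar>fst z\<bar> < \<bar>snd z\<bar>}"
  have cone: "((p * x, q * x + r * y) \<in> C) = ((x, y) \<in> {z. \<bar>fst z\<bar> < t * \<bar>snd z\<bar>})" for x y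
    using \<open>p \<noteq> 0\<close> by (simp add: C_def \<open>q = 0\<close> abs_mult rt mult.assoc)
  have [measurable]: "C \<in> sets (borel \<Otimes>\<^sub>M borel)"
  proof -
    have "{z \<in> space (borel \<Otimes>\<^sub>M borel). \<bar>fst z\<bar> < \<bar>snd z :: real\<bar>} \<in> sets (borel \<Otimes>\<^sub>M borel)"
      by measurable
    then show ?thesis by (simp add: C_def space_pair_measure)
  qed
  define B where "B = {Y \<in> space ?P. (\<Sum>i\<in>I. (a i + b i) * Y i, \<Sum>i\<in>I. (a i - b i) * Y i) \<in> C}"
  have [measurable]: "B \<in> sets ?P" unfolding B_def by measurable
  have "emeasure ?P B = (\<integral>\<^sup>+Y. indicator C (\<Sum>i\<in>I. (a i + b i) * Y i, \<Sum>i\<in>I. (a i - b i) * Y i) \<partial>?P)"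
  proof -
    have "emeasure ?P B = (\<integral>\<^sup>+Y. indicator B Y \<partial>?P)" by simp
    also have "\<dots> = (\<integral>\<^sup>+Y. indicator C (\<Sum>i\<in>I. (a i + b i) * Y i, \<Sum>i\<in>I. (a i - b i) * Y i) \<partial>?P)"
      by (rule nn_integral_cong) (simp add: B_def indicator_def)
    finally show ?thesis .
  qed
  also have "\<dots> = (\<integral>\<^sup>+x. \<integral>\<^sup>+y. indicator {z. \<bar>fst z\<bar> < t * \<bar>snd z\<bar>} (x, y) \<partial>gaussian \<partial>gaussian)"
    using law[rule_format, of "indicator C"] by (simp add: indicator_def cone)
  also have "\<dots> = ennreal (2 / pi * arctan t)"
    by (rule gaussian_cone) fact
  also have "2 / pi * arctan t = \<phi> / pi"
    using phi by (simp add: t_def arctan_tan)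
  finally have "measure ?P B = \<phi> / pi"
    using phi by (simp add: P.emeasure_eq_measure)
  \<comment> \<open>The strict inequality says that \<open>x\<close> and \<open>y\<close> have
    opposite strict signs. Ties such as \<open>x > 0\<close>, \<open>y = 0\<close> lie in the larger
    set only, and an inclusion suffices for the lower bound.\<close>
  moreover have "B \<subseteq> ?A"
  proof
    fix Y assume "Y \<in> B"
    define x where "x = (\<Sum>i\<in>I. a i * Y i)"
    define y where "y = (\<Sum>i\<in>I. b i * Y i)"
    have "\<bar>x + y\<bar> < \<bar>x - y\<bar>"
      using \<open>Y \<in> B\<close> by (simp add: B_def C_def x_def y_def algebra_simps sum.distrib sum_subtractf)
    then show "Y \<in> ?A"
      using \<open>Y \<in> B\<close> by (auto simp: B_def simp flip: x_def y_def)
  qed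
  moreover have "?A \<in> sets ?P" by measurable
  ultimately show ?thesis using P.finite_measure_mono[of B ?A] by simp
qed

section \<open>Spheres in regular graphs of high girth\<close>

definition adj :: "'v set set \<Rightarrow> ('v \<times> 'v) set" where
  "adj E = {(x, y). {x, y} \<in> E}"

text \<open>Distance is expressed through relation powers, as in \<open>graph_ball\<close>; a vertex
  that cannot be reached lies in no sphere, so no default distance is involved.\<close>

definition graph_sphere :: "'v set set \<Rightarrow> 'v \<Rightarrow> nat \<Rightarrow> 'v set" where
  "graph_sphere E u i = {v. (u, v) \<in> adj E ^^ i \<and> (\<forall>j<i. (u, v) \<notin> adj E ^^ j)}"

lemma adj_sym: "(x, y) \<in> adj E \<longleftrightarrow> (y, x) \<in> adj E"
  by (simp add: adj_def insert_commute)

lemma adj_relpow_sym: "(x, y) \<in> adj E ^^ n \<longleftrightarrow> (y, x) \<in> adj E ^^ n"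
proof -
  have "(y, x) \<in> adj E ^^ n" if "(x, y) \<in> adj E ^^ n" for x y
    using that
  proof (induction n arbitrary: y)
    case (Suc n)
    then show ?case by (meson adj_sym relpow_Suc_D2 relpow_Suc_E relpow_Suc_I2)
  qed simp
  then show ?thesis by blast
qed

lemma sphere_sym: "v \<in> graph_sphere E u i \<longleftrightarrow> u \<in> graph_sphere E v i"
  unfolding graph_sphere_def by (simp add: adj_relpow_sym[of u v])

lemma sphere_0: "graph_sphere E u 0 = {u}"
  by (auto simp: graph_sphere_def)

lemma sphere_disjoint: "v \<in> graph_sphere E u i \<Longrightarrow> v \<in> graph_sphere E u j \<Longrightarrow> i = j"
  unfolding graph_sphere_def by (metis (no_types, lifting) linorder_neqE_nat mem_Collect_eq)

lemma relpow_sphere: "(u, v) \<in> adj E ^^ n \<Longrightarrow> \<exists>i\<le>n. v \<in> graph_sphere E u i"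
proof -
  assume a: "(u, v) \<in> adj E ^^ n"
  define i where "i = (LEAST i. (u, v) \<in> adj E ^^ i)"
  have "i \<le> n" "(u, v) \<in> adj E ^^ i" "\<forall>j<i. (u, v) \<notin> adj E ^^ j"
    unfolding i_def using a by (auto intro: Least_le LeastI dest: not_less_Least)
  then show ?thesis by (auto simp: graph_sphere_def)
qed

lemma sphere_step:
  assumes "x \<in> graph_sphere E u i" "(x, y) \<in> adj E"
  obtains j where "y \<in> graph_sphere E u j" "j \<le> Suc i" "i \<le> Suc j"
proof -
  have "(u, y) \<in> adj E ^^ Suc i"
    using assms by (intro relpow_Suc_I) (auto simp: graph_sphere_def)
  from relpow_sphere[OF this] obtain j where j: "j \<le> Suc i" "y \<in> graph_sphere E u j" by blast
  have "(u, x) \<in> adj E ^^ Suc j"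
    using assms j adj_sym[of x y] by (intro relpow_Suc_I[of _ y]) (auto simp: graph_sphere_def)
  then have "i \<le> Suc j"
    using assms(1) unfolding graph_sphere_def by (metis (mono_tags, lifting) linorder_not_less mem_Collect_eq)
  then show ?thesis using that j by blast
qed

lemma sphere_Suc_parent:
  assumes "x \<in> graph_sphere E u (Suc i)"
  obtains y where "y \<in> graph_sphere E u i" "(y, x) \<in> adj E"
proof -
  obtain y where y: "(u, y) \<in> adj E ^^ i" "(y, x) \<in> adj E"
    using assms by (auto simp: graph_sphere_def)
  from relpow_sphere[OF y(1)] obtain j where j: "j \<le> i" "y \<in> graph_sphere E u j" by blast
  from sphere_step[OF j(2) y(2)] obtain j' where "x \<in> graph_sphere E u j'" "j' \<le> Suc j" by blast
  then have "Suc i \<le> Suc j" using sphere_disjoint[OF assms] by blast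
  then show ?thesis using that y j by auto
qed

lemma sphere_geodesic:
  assumes "x \<in> graph_sphere E u i"
  shows "\<exists>a. a 0 = u \<and> a i = x \<and> (\<forall>j\<le>i. a j \<in> graph_sphere E u j) \<and> (\<forall>j<i. (a j, a (Suc j)) \<in> adj E)"
  using assms
proof (induction i arbitrary: x)
  case 0
  then show ?case by (intro exI[of _ "\<lambda>_. x"]) (auto simp: sphere_0)
next
  case (Suc i)
  obtain y where y: "y \<in> graph_sphere E u i" "(y, x) \<in> adj E" using sphere_Suc_parent[OF Suc.prems] .
  from Suc.IH[OF y(1)] obtain a where a: "a 0 = u" "a i = y" "\<forall>j\<le>i. a j \<in> graph_sphere E u j"
    "\<forall>j<i. (a j, a (Suc j)) \<in> adj E" by blast
  show ?case
    by (rule exI[of _ "a(Suc i := x)"]) (use a y Suc.prems in \<open>auto simp: le_Suc_eq less_Suc_eq\<close>)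
qed

lemma adj_in_verts:
  assumes "simple_graph V E" "(x, y) \<in> adj E"
  shows "x \<in> V" "y \<in> V"
  using assms by (auto simp: adj_def simple_graph_def)

lemma graph_sphere_subset:
  assumes "simple_graph V E" "u \<in> V"
  shows "graph_sphere E u i \<subseteq> V"
proof
  fix x assume "x \<in> graph_sphere E u i"
  then show "x \<in> V"
    using assms by (cases i) (auto simp: sphere_0 elim!: sphere_Suc_parent dest: adj_in_verts)
qed

text \<open>Take a shortest segment of the walk with equal ends. Its length is not 1 (no loops) and
  not 2 (no backtracking), and minimality makes its vertices distinct, so it is a cycle.\<close>

lemma nonbacktracking_closed_walk_imp_cycle:
  assumes loopless: "\<And>x. (x, x) \<notin> adj E"
    and walk: "\<And>i. i < m \<Longrightarrow> (p i, p (Suc i)) \<in> adj E"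
    and nb: "\<And>i. i + 2 \<le> m \<Longrightarrow> p i \<noteq> p (i + 2)"
    and closed: "p 0 = p m" "m > 0"
  shows "\<exists>c. is_cycle E c \<and> length c \<le> m"
proof -
  define P where "P d \<longleftrightarrow> d > 0 \<and> (\<exists>i. i + d \<le> m \<and> p i = p (i + d))" for d
  have "P m" using closed by (auto simp: P_def)
  define d where "d = (LEAST d. P d)"
  have "P d" unfolding d_def using \<open>P m\<close> by (rule LeastI)
  have min: "\<not> P d'" if "d' < d" for d' using that not_less_Least unfolding d_def by blast
  from \<open>P d\<close> obtain i where i: "d > 0" "i + d \<le> m" "p i = p (i + d)" by (auto simp: P_def)
  have "d \<noteq> 1" using i walk[of i] loopless by auto
  have "d \<noteq> 2" using i nb[of i] by auto
  have d3: "d \<ge> 3" using i \<open>d \<noteq> 1\<close> \<open>d \<noteq> 2\<close> by linarith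
  define c where "c = map p [i..<i + d]"
  have dist: "p (i + j) \<noteq> p (i + j')" if "j < j'" "j' < d" for j j'
  proof
    assume "p (i + j) = p (i + j')"
    then have "P (j' - j)" using that i unfolding P_def by (intro conjI exI[of _ "i + j"]) auto
    then show False using min[of "j' - j"] that by auto
  qed
  have "distinct c"
    unfolding distinct_conv_nth
  proof (intro allI impI)
    fix j j' assume "j < length c" "j' < length c" "j \<noteq> j'"
    then show "c ! j \<noteq> c ! j'"
      using dist[of j j'] dist[of j' j] by (auto simp: c_def neq_iff)
  qed
  moreover have "{c ! j, c ! (Suc j mod length c)} \<in> E" if "j < length c" for j
  proof (cases "Suc j = d")
    case True
    then show ?thesis using walk[of "i + j"] i d3 by (auto simp: c_def adj_def)
  next
    case False
    then show ?thesis using that walk[of "i + j"] i by (auto simp: c_def adj_def)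
  qed
  ultimately have "is_cycle E c" using d3 by (simp add: is_cycle_def c_def)
  moreover have "length c \<le> m" using i by (simp add: c_def)
  ultimately show ?thesis by blast
qed

locale high_girth_graph =
  fixes V :: "'v set" and E :: "'v set set" and D k :: nat
  assumes graph: "simple_graph V E" and reg: "regular V E D"
    and girth: "girth E > enat (2 * k + 1)"
begin

lemma finite_V: "finite V" and edge: "e \<in> E \<Longrightarrow> e \<subseteq> V \<and> card e = 2"
  using graph by (auto simp: simple_graph_def)

lemma finite_E: "finite E"
  using edge by (intro finite_subset[OF _ finite_Pow_iff[THEN iffD2, OF finite_V]]) auto

lemma adj_irrefl: "(x, x) \<notin> adj E"
  using edge[of "{x}"] by (auto simp: adj_def)

lemmas adj_in_V = adj_in_verts[OF graph]

lemma no_short_cycle: "is_cycle E c \<Longrightarrow> length c > 2 * k + 1"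
proof -
  assume "is_cycle E c"
  then have "girth E \<le> enat (length c)" unfolding girth_def by (intro INF_lower) simp
  with girth have "enat (2 * k + 1) < enat (length c)" by (rule less_le_trans)
  then show ?thesis by simp
qed

lemma no_short_closed_walk:
  assumes "\<And>i. i < m \<Longrightarrow> (p i, p (Suc i)) \<in> adj E"
    and "\<And>i. i + 2 \<le> m \<Longrightarrow> p i \<noteq> p (i + 2)"
    and "p 0 = p m" "m > 0" "m \<le> 2 * k + 1"
  shows False
proof -
  obtain c where "is_cycle E c" "length c \<le> m"
    using nonbacktracking_closed_walk_imp_cycle[OF adj_irrefl assms(1-4)] by blast
  with no_short_cycle[of c] assms(5) show False by simp
qed

text \<open>Geodesics from \<open>u\<close> to both ends of such an edge would close up to a
  nonbacktracking walk of length \<open>2 * i + 1\<close>, at most \<open>2 * k + 1\<close>.\<close>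

lemma sphere_no_inner_edge:
  assumes "i \<le> k" "x \<in> graph_sphere E u i" "y \<in> graph_sphere E u i"
  shows "(x, y) \<notin> adj E"
proof
  assume xy: "(x, y) \<in> adj E"
  obtain a where a: "a 0 = u" "a i = x" "\<forall>j\<le>i. a j \<in> graph_sphere E u j" "\<forall>j<i. (a j, a (Suc j)) \<in> adj E"
    using sphere_geodesic[OF assms(2)] by blast
  obtain b where b: "b 0 = u" "b i = y" "\<forall>j\<le>i. b j \<in> graph_sphere E u j" "\<forall>j<i. (b j, b (Suc j)) \<in> adj E"
    using sphere_geodesic[OF assms(3)] by blast
  define p where "p j = (if j \<le> i then a j else b (2 * i + 1 - j))" for j
  \<comment> \<open>The distance of \<open>p j\<close> from \<open>u\<close>. It differs between
    \<open>j\<close> and \<open>j + 2\<close>, also across the edge at the far end, which excludes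
    backtracking.\<close>
  define l where "l j = (if j \<le> i then j else 2 * i + 1 - j)" for j
  have l: "p j \<in> graph_sphere E u (l j)" if "j \<le> 2 * i + 1" for j
    using that a b by (auto simp: p_def l_def)
  show False
  proof (rule no_short_closed_walk[of "2 * i + 1" p])
    fix j assume j: "j < 2 * i + 1"
    consider "j < i" | "j = i" | "j > i" by linarith
    then show "(p j, p (Suc j)) \<in> adj E"
    proof cases
      case 3
      define j' where "j' = 2 * i - j"
      have "2 * i + 1 - j = Suc j'" "2 * i + 1 - Suc j = j'" "j' < i" using 3 j by (auto simp: j'_def)
      then show ?thesis using b(4) 3 by (auto simp: p_def adj_sym[of "b (Suc j')"])
    qed (use a b xy in \<open>auto simp: p_def\<close>)
  next
    fix j assume j: "j + 2 \<le> 2 * i + 1"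
    have "l j \<noteq> l (j + 2)" using j by (auto simp: l_def) presburger
    then show "p j \<noteq> p (j + 2)" using l[of j] l[of "j + 2"] j sphere_disjoint by (metis add_leD1)
  qed (use a b assms in \<open>auto simp: p_def\<close>)
qed

text \<open>Two parents would give a closed walk of length \<open>2 * i + 2\<close>, at most
  \<open>2 * k\<close>, through \<open>x\<close>.\<close>

lemma sphere_unique_parent:
  assumes "Suc i \<le> k" "x \<in> graph_sphere E u (Suc i)" "y \<in> graph_sphere E u i" "(y, x) \<in> adj E"
    "z \<in> graph_sphere E u i" "(z, x) \<in> adj E"
  shows "y = z"
proof (rule ccontr)
  assume "y \<noteq> z"
  obtain a where a: "a 0 = u" "a i = y" "\<forall>j\<le>i. a j \<in> graph_sphere E u j" "\<forall>j<i. (a j, a (Suc j)) \<in> adj E"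
    using sphere_geodesic[OF assms(3)] by blast
  obtain b where b: "b 0 = u" "b i = z" "\<forall>j\<le>i. b j \<in> graph_sphere E u j" "\<forall>j<i. (b j, b (Suc j)) \<in> adj E"
    using sphere_geodesic[OF assms(5)] by blast
  define p where "p j = (if j \<le> i then a j else if j = Suc i then x else b (2 * i + 2 - j))" for j
  \<comment> \<open>Again the distance from \<open>u\<close>. Now the levels at \<open>j\<close> and
    \<open>j + 2\<close> agree for \<open>j = i\<close>, on the two sides of \<open>x\<close>; there
    \<open>y \<noteq> z\<close> excludes backtracking.\<close>
  define l where "l j = (if j \<le> Suc i then j else 2 * i + 2 - j)" for j
  have l: "p j \<in> graph_sphere E u (l j)" if "j \<le> 2 * i + 2" for j
    using that a b assms(2) by (auto simp: p_def l_def)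
  show False
  proof (rule no_short_closed_walk[of "2 * i + 2" p])
    fix j assume j: "j < 2 * i + 2"
    consider "j < i" | "j = i" | "j = Suc i" | "j > Suc i" by linarith
    then show "(p j, p (Suc j)) \<in> adj E"
    proof cases
      case 4
      define j' where "j' = 2 * i + 1 - j"
      have "2 * i + 2 - j = Suc j'" "2 * i + 2 - Suc j = j'" "j' < i" using 4 j by (auto simp: j'_def)
      then show ?thesis using b(4) 4 by (auto simp: p_def adj_sym[of "b (Suc j')"])
    qed (use a b assms(4,6) in \<open>auto simp: p_def adj_sym[of x]\<close>)
  next
    fix j assume j: "j + 2 \<le> 2 * i + 2"
    show "p j \<noteq> p (j + 2)"
    proof (cases "j = i")
      case True
      then show ?thesis using \<open>y \<noteq> z\<close> a b by (simp add: p_def)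
    next
      case False
      then have "l j \<noteq> l (j + 2)" using j by (auto simp: l_def)
      then show ?thesis using l[of j] l[of "j + 2"] j sphere_disjoint by (metis add_leD1)
    qed
  qed (use a b assms in \<open>auto simp: p_def\<close>)
qed

lemma card_neighbours:
  assumes "x \<in> V"
  shows "card {y. (x, y) \<in> adj E} = D" "finite {y. (x, y) \<in> adj E}"
proof -
  have "bij_betw (\<lambda>y. {x, y}) {y. (x, y) \<in> adj E} {e \<in> E. x \<in> e}"
    unfolding bij_betw_def
  proof
    show "inj_on (\<lambda>y. {x, y}) {y. (x, y) \<in> adj E}"
      by (auto simp: inj_on_def doubleton_eq_iff)
    have "\<exists>y. e = {x, y}" if "e \<in> E" "x \<in> e" for e
      using edge[OF that(1)] that(2) by (auto simp: card_2_iff)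
    then show "(\<lambda>y. {x, y}) ` {y. (x, y) \<in> adj E} = {e \<in> E. x \<in> e}"
      by (auto simp: adj_def image_iff)
  qed
  then show "card {y. (x, y) \<in> adj E} = D"
    using reg assms by (simp add: bij_betw_same_card regular_def)
  show "finite {y. (x, y) \<in> adj E}"
    by (rule finite_subset[OF _ finite_V]) (auto dest: adj_in_V)
qed

lemmas sphere_subset = graph_sphere_subset[OF graph]

lemma finite_sphere: "u \<in> V \<Longrightarrow> finite (graph_sphere E u i)"
  using sphere_subset finite_V finite_subset by blast

text \<open>Of the \<open>D\<close> neighbours of a vertex in a sphere one is its parent and none
  lies in the same sphere, so \<open>D - 1\<close> are children; unique parents keep the sets of
  children disjoint.\<close>

lemma card_sphere:
  assumes "u \<in> V"
  shows "Suc i \<le> k \<Longrightarrow> card (graph_sphere E u (Suc i)) = D * (D - 1) ^ i"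
proof (induction i)
  case 0
  have "graph_sphere E u (Suc 0) = {y. (u, y) \<in> adj E}"
    using adj_irrefl by (auto simp: graph_sphere_def)
  then show ?case using card_neighbours[OF assms] by simp
next
  case (Suc i)
  define S where "S = graph_sphere E u (Suc i)"
  define N where "N x = {y. (x, y) \<in> adj E} \<inter> graph_sphere E u (Suc (Suc i))" for x
  have "graph_sphere E u (Suc (Suc i)) = (\<Union>x\<in>S. N x)"
    by (auto simp: N_def S_def elim: sphere_Suc_parent)
  also have "card \<dots> = (\<Sum>x\<in>S. card (N x))"
  proof (rule card_UN_disjoint)
    show "finite S" using finite_sphere assms by (simp add: S_def)
    show "\<forall>x\<in>S. finite (N x)" using finite_sphere assms by (simp add: N_def)
    show "\<forall>x\<in>S. \<forall>x'\<in>S. x \<noteq> x' \<longrightarrow> N x \<inter> N x' = {}"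
      using sphere_unique_parent[OF Suc.prems] by (auto simp: N_def S_def)
  qed
  also have "\<dots> = (\<Sum>x\<in>S. D - 1)"
  proof (rule sum.cong)
    fix x assume "x \<in> S"
    then have x: "x \<in> graph_sphere E u (Suc i)" by (simp add: S_def)
    obtain y where y: "y \<in> graph_sphere E u i" "(y, x) \<in> adj E" by (rule sphere_Suc_parent[OF x])
    have "N x = {y. (x, y) \<in> adj E} - {y}"
    proof (intro equalityI subsetI)
      fix z assume "z \<in> N x"
      then show "z \<in> {y. (x, y) \<in> adj E} - {y}"
        using y sphere_disjoint[of y E u i "Suc (Suc i)"] by (auto simp: N_def)
    next
      fix z assume z: "z \<in> {y. (x, y) \<in> adj E} - {y}"
      then obtain j where j: "z \<in> graph_sphere E u j" "j \<le> Suc (Suc i)" "Suc i \<le> Suc j"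
        using sphere_step[OF x, of z] by auto
      have "j \<noteq> Suc i" using sphere_no_inner_edge[of "Suc i" x u z] x j z Suc.prems by auto
      moreover have "j \<noteq> i"
        using sphere_unique_parent[of i x u y z] x y j z Suc.prems adj_sym[of x z] by auto
      ultimately have "j = Suc (Suc i)" using j by linarith
      then show "z \<in> N x" using j z by (simp add: N_def)
    qed
    moreover have "x \<in> V" using adj_in_V y by blast
    ultimately show "card (N x) = D - 1"
      using card_neighbours y adj_sym[of x y] by simp
  qed simp
  also have "\<dots> = D * (D - 1) ^ Suc i"
    using Suc by (simp add: S_def)
  finally show ?case .
qed

text \<open>Across an edge \<open>u w\<close>, the sphere of radius \<open>i\<close> around \<open>u\<close> splits into the vertices on the
  side of \<open>u\<close> and those on the side of \<open>w\<close>, at distance \<open>i + 1\<close> and \<open>i - 1\<close> from \<open>w\<close>.\<close>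

lemma sphere_edge_split:
  assumes "(u, w) \<in> adj E" "Suc i \<le> k"
  shows "graph_sphere E u (Suc i) =
    (graph_sphere E u (Suc i) \<inter> graph_sphere E w (Suc (Suc i))) \<union> (graph_sphere E w i \<inter> graph_sphere E u (Suc i))"
proof -
  have "x \<in> graph_sphere E w (Suc (Suc i)) \<or> x \<in> graph_sphere E w i" if x: "x \<in> graph_sphere E u (Suc i)" for x
  proof -
    \<comment> \<open>Both ends of the edge are viewed from \<open>x\<close>: their distances differ
      by at most one, and equality would place the edge inside a sphere around
      \<open>x\<close>.\<close>
    obtain j where j: "w \<in> graph_sphere E x j" "j \<le> Suc (Suc i)" "Suc i \<le> Suc j"
      using sphere_step[of u E x "Suc i" w] assms(1) x sphere_sym[of x E u] by auto
    have "j \<noteq> Suc i"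
      using sphere_no_inner_edge[of "Suc i" u x w] x j assms sphere_sym[of x E u] by auto
    then have "j = i \<or> j = Suc (Suc i)" using j by linarith
    then show ?thesis using j(1) sphere_sym[of x E w] by auto
  qed
  then show ?thesis by blast
qed

text \<open>The induction exchanges \<open>u\<close> and \<open>w\<close>: the part of the sphere
  beyond \<open>w\<close> is counted by the hypothesis for the reversed edge, and subtracting it
  from the sphere leaves \<open>D * (D - 1) ^ i - (D - 1) ^ i\<close>.\<close>

lemma card_side:
  assumes "(u, w) \<in> adj E" "Suc i \<le> k"
  shows "card (graph_sphere E u i \<inter> graph_sphere E w (Suc i)) = (D - 1) ^ i"
  using assms
proof (induction i arbitrary: u w)
  case 0
  have "u \<in> graph_sphere E w (Suc 0)" using adj_irrefl 0 by (auto simp: graph_sphere_def adj_sym[of u])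
  then have "graph_sphere E u 0 \<inter> graph_sphere E w (Suc 0) = {u}" by (auto simp: sphere_0)
  then show ?case by simp
next
  case (Suc i)
  have u: "u \<in> V" using Suc.prems adj_in_V by blast
  have "D * (D - 1) ^ i = card (graph_sphere E u (Suc i))"
    using card_sphere[OF u] Suc.prems by simp
  also have "\<dots> = card (graph_sphere E u (Suc i) \<inter> graph_sphere E w (Suc (Suc i))) + card (graph_sphere E w i \<inter> graph_sphere E u (Suc i))"
  proof (subst (1) sphere_edge_split[of u w i])
    show "card (graph_sphere E u (Suc i) \<inter> graph_sphere E w (Suc (Suc i)) \<union> graph_sphere E w i \<inter> graph_sphere E u (Suc i)) =
      card (graph_sphere E u (Suc i) \<inter> graph_sphere E w (Suc (Suc i))) + card (graph_sphere E w i \<inter> graph_sphere E u (Suc i))"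
      using finite_sphere[OF u] sphere_disjoint[of _ E w i "Suc (Suc i)"]
      by (intro card_Un_disjoint) auto
  qed (use Suc.prems in auto)
  also have "card (graph_sphere E w i \<inter> graph_sphere E u (Suc i)) = (D - 1) ^ i"
    using Suc.prems adj_sym[of u w] by (intro Suc.IH) auto
  finally have "card (graph_sphere E u (Suc i) \<inter> graph_sphere E w (Suc (Suc i))) = D * (D - 1) ^ i - (D - 1) ^ i"
    by simp
  then show ?case by (simp only: power_Suc diff_mult_distrib mult_1)
qed

end

section \<open>The local rule and its correlations\<close>

lemma graph_sphere_eq_reach:
  "graph_sphere E u i = (adj E ^^ i) `` {u} - (\<Union>j<i. (adj E ^^ j) `` {u})"
  by (auto simp: graph_sphere_def)

lemma reach_subset_verts:
  assumes "simple_graph V E" "u \<in> V"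
  shows "(adj E ^^ i) `` {u} \<subseteq> V"
  using assms relpow_sphere graph_sphere_subset by fast

text \<open>As \<open>\<phi>\<close> is injective on \<open>V\<close> only, each step of the
  induction uses that the vertices reached stay in \<open>V\<close>.\<close>

lemma reach_image:
  assumes g: "simple_graph V E" and \<phi>: "inj_on \<phi> V" and u: "u \<in> V"
  shows "(adj ((\<lambda>e. \<phi> ` e) ` E) ^^ i) `` {\<phi> u} = \<phi> ` ((adj E ^^ i) `` {u})"
proof (induction i)
  case (Suc i)
  have step: "adj ((\<lambda>e. \<phi> ` e) ` E) `` {\<phi> x} = \<phi> ` (adj E `` {x})" if "x \<in> V" for x
  proof (intro equalityI subsetI)
    fix z assume "z \<in> adj ((\<lambda>e. \<phi> ` e) ` E) `` {\<phi> x}"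
    then obtain e where e: "e \<in> E" "{\<phi> x, z} = \<phi> ` e" by (auto simp: adj_def)
    then have "e \<subseteq> V" "card e = 2" using g by (auto simp: simple_graph_def)
    have "x \<in> e" using e \<open>e \<subseteq> V\<close> that \<phi> by (metis imageE inj_onD insertI1 subsetD)
    then obtain y where "e = {x, y}" using \<open>card e = 2\<close> by (auto simp: card_2_iff)
    then show "z \<in> \<phi> ` (adj E `` {x})" using e by (auto simp: adj_def doubleton_eq_iff)
  next
    fix z assume "z \<in> \<phi> ` (adj E `` {x})"
    then obtain y where "{x, y} \<in> E" "z = \<phi> y" by (auto simp: adj_def)
    then show "z \<in> adj ((\<lambda>e. \<phi> ` e) ` E) `` {\<phi> x}"
      by (auto simp: adj_def intro!: image_eqI[of _ _ "{x, y}"])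
  qed
  have "(adj ((\<lambda>e. \<phi> ` e) ` E) ^^ Suc i) `` {\<phi> u} =
      adj ((\<lambda>e. \<phi> ` e) ` E) `` (\<phi> ` ((adj E ^^ i) `` {u}))"
    by (simp add: relcomp_Image Suc)
  also have "\<dots> = (\<Union>x\<in>(adj E ^^ i) `` {u}. adj ((\<lambda>e. \<phi> ` e) ` E) `` {\<phi> x})" by blast
  also have "\<dots> = (\<Union>x\<in>(adj E ^^ i) `` {u}. \<phi> ` (adj E `` {x}))"
    using reach_subset_verts[OF g u, of i] by (intro SUP_cong refl step) blast
  also have "\<dots> = \<phi> ` ((adj E ^^ Suc i) `` {u})" by (auto simp: relcomp_Image)
  finally show ?case .
qed simp

lemma graph_sphere_image:
  assumes g: "simple_graph V E" and \<phi>: "inj_on \<phi> V" and u: "u \<in> V"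
  shows "graph_sphere ((\<lambda>e. \<phi> ` e) ` E) (\<phi> u) i = \<phi> ` graph_sphere E u i"
proof -
  have "(\<Union>j<i. (adj E ^^ j) `` {u}) \<subseteq> V" using reach_subset_verts[OF g u] by blast
  then show ?thesis
    unfolding graph_sphere_eq_reach reach_image[OF assms] image_UN[symmetric]
    using reach_subset_verts[OF g u, of i] \<phi> by (intro inj_on_image_set_diff[symmetric]) auto
qed

text \<open>The weight of a vertex at distance \<open>i\<close> from a root of degree \<open>d\<close> is \<open>(- 1 / sqrt (d - 1)) ^ i\<close>.
  For \<open>d = 1\<close> the division by zero makes all weights but the one of the root vanish.\<close>

definition decay :: "nat \<Rightarrow> real" where
  "decay d = - 1 / sqrt (real d - 1)"

text \<open>The degree is counted at the root of the view itself, so a single rule serves all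
  \<open>D\<close>.\<close>

definition local_field :: "nat \<Rightarrow> ('v, real) labeled_graph \<Rightarrow> real" where
  "local_field k H = (\<Sum>i\<le>k. decay (card {e \<in> edges H. root H \<in> e}) ^ i *
     (\<Sum>v\<in>graph_sphere (edges H) (root H) i. label H v))"

definition sign_rule :: "nat \<Rightarrow> ('v, real) labeled_graph \<Rightarrow> int" where
  "sign_rule k H = (if local_field k H > 0 then 1 else - 1)"

lemma local_field_isomorphic:
  assumes "H \<in> labeled_graphs S" "isomorphic H H'"
  shows "local_field k H = local_field k H'"
proof -
  from assms(2) obtain \<phi> where bij: "bij_betw \<phi> (verts H) (verts H')"
    and E: "(\<lambda>e. \<phi> ` e) ` edges H = edges H'" and r: "\<phi> (root H) = root H'"
    and lab: "\<forall>v\<in>verts H. label H' (\<phi> v) = label H v"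
    unfolding isomorphic_def by blast
  have g: "simple_graph (verts H) (edges H)" and rt: "root H \<in> verts H"
    using assms(1) by (auto simp: labeled_graphs_def)
  have inj: "inj_on \<phi> (verts H)" using bij by (simp add: bij_betw_def)
  have sub: "e \<subseteq> verts H" if "e \<in> edges H" for e using g that by (auto simp: simple_graph_def)
  have mem: "\<phi> (root H) \<in> \<phi> ` e \<longleftrightarrow> root H \<in> e" if "e \<in> edges H" for e
    by (rule inj_on_image_mem_iff[OF inj rt sub[OF that]])
  have "{e \<in> edges H'. root H' \<in> e} = (\<lambda>e. \<phi> ` e) ` {e \<in> edges H. \<phi> (root H) \<in> \<phi> ` e}"
    unfolding E[symmetric] r[symmetric] by blast
  also have "{e \<in> edges H. \<phi> (root H) \<in> \<phi> ` e} = {e \<in> edges H. root H \<in> e}"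
    using mem by blast
  finally have "{e \<in> edges H'. root H' \<in> e} = (\<lambda>e. \<phi> ` e) ` {e \<in> edges H. root H \<in> e}" .
  moreover have "inj_on (\<lambda>e. \<phi> ` e) {e \<in> edges H. root H \<in> e}"
    using sub by (intro inj_on_subset[OF inj_on_image_Pow[OF inj]]) auto
  ultimately have deg: "card {e \<in> edges H'. root H' \<in> e} = card {e \<in> edges H. root H \<in> e}"
    by (simp add: card_image)
  have "(\<Sum>v\<in>graph_sphere (edges H') (root H') i. label H' v) =
    (\<Sum>v\<in>graph_sphere (edges H) (root H) i. label H v)" for i
  proof -
    have sub: "graph_sphere (edges H) (root H) i \<subseteq> verts H" by (rule graph_sphere_subset[OF g rt])
    then have "inj_on \<phi> (graph_sphere (edges H) (root H) i)" by (rule inj_on_subset[OF inj])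
    then show ?thesis
      unfolding E[symmetric] r[symmetric] graph_sphere_image[OF g inj rt]
      using sub lab by (simp add: sum.reindex subset_iff)
  qed
  then show ?thesis by (simp add: local_field_def deg)
qed

lemma local_algorithm_sign_rule: "local_algorithm gaussian (sign_rule k)"
  unfolding local_algorithm_def
proof (intro conjI ballI allI impI)
  show "prob_space gaussian" by (rule gaussian.prob_space_axioms)
next
  fix H H' :: "('v, real) labeled_graph"
  assume "H \<in> labeled_graphs (space gaussian)" "isomorphic H H'"
  then show "sign_rule k H = sign_rule k H'"
    by (simp add: sign_rule_def local_field_isomorphic)
next
  fix V :: "'v set" and E r assume "simple_graph V E \<and> r \<in> V"
  then have sub: "graph_sphere E r i \<subseteq> V" for i by (simp add: graph_sphere_subset)
  have "(\<lambda>Y. local_field k \<lparr>verts = V, edges = E, root = r, label = Y\<rparr>) \<in> borel_measurable (PiM V (\<lambda>_. gaussian))"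
  proof -
    have [measurable]: "(\<lambda>Y. Y v) \<in> borel_measurable (PiM V (\<lambda>_. gaussian))" if "v \<in> graph_sphere E r i" for v i
      using measurable_component_singleton[of v V "\<lambda>_. gaussian"] sub that
      unfolding measurable_cong_sets[OF refl sets_gaussian] by blast
    show ?thesis
      unfolding local_field_def by (auto intro!: borel_measurable_sum borel_measurable_times)
  qed
  then show "(\<lambda>Y. sign_rule k \<lparr>verts = V, edges = E, root = r, label = Y\<rparr>)
      \<in> measurable (PiM V (\<lambda>_. gaussian)) (count_space {-1, 1})"
    unfolding sign_rule_def by measurable
qed (simp add: sign_rule_def)

section \<open>Variance and covariance of the fields\<close>

context high_girth_graph
begin

lemma local_field_local_view:
  assumes "u \<in> V" "k \<ge> 1"
  shows "local_field k (local_view k E Y u) = (\<Sum>i\<le>k. decay D ^ i * (\<Sum>v\<in>graph_sphere E u i. Y v))"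
proof -
  define B where "B = graph_ball E k u"
  define F where "F = {e \<in> E. e \<subseteq> B}"
  have reach_B: "(adj E ^^ i) `` {u} \<subseteq> B" if "i \<le> k" for i
    using that by (auto simp: B_def graph_ball_def adj_def)
  \<comment> \<open>Walks of length at most \<open>k\<close> from \<open>u\<close> stay in the ball,
    so the induced subgraph has the same distances from \<open>u\<close> up to
    \<open>k\<close>.\<close>
  have reach: "(adj F ^^ i) `` {u} = (adj E ^^ i) `` {u}" if "i \<le> k" for i
    using that
  proof (induction i)
    case (Suc i)
    have "(adj F ^^ Suc i) `` {u} = adj F `` ((adj F ^^ i) `` {u})" by auto
    also have "\<dots> = adj F `` ((adj E ^^ i) `` {u})" using Suc by simp
    also have "\<dots> = adj E `` ((adj E ^^ i) `` {u})"
    proof (intro equalityI subsetI)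
      fix z assume "z \<in> adj E `` ((adj E ^^ i) `` {u})"
      then obtain y where y: "y \<in> (adj E ^^ i) `` {u}" "(y, z) \<in> adj E" by blast
      then have "z \<in> (adj E ^^ Suc i) `` {u}" by auto
      then have "z \<in> B" "y \<in> B" using y reach_B[of i] reach_B[of "Suc i"] Suc.prems by auto
      then have "(y, z) \<in> adj F" using y by (simp add: adj_def F_def)
      then show "z \<in> adj F `` ((adj E ^^ i) `` {u})" using y by blast
    qed (auto simp: adj_def F_def)
    also have "\<dots> = (adj E ^^ Suc i) `` {u}" by auto
    finally show ?case .
  qed simp
  have sphere: "graph_sphere F u i = graph_sphere E u i" if "i \<le> k" for i
    using that by (simp add: graph_sphere_eq_reach reach)
  have sub: "graph_sphere E u i \<subseteq> B" if "i \<le> k" for i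
    using reach_B[OF that] by (auto simp: graph_sphere_eq_reach)
  \<comment> \<open>Radius at least 1 shows the root all its edges, so the degree read from the view
    is \<open>D\<close>.\<close>
  have "e \<subseteq> B" if eE: "e \<in> E" and ue: "u \<in> e" for e
  proof -
    obtain y where e: "e = {u, y}" using edge[OF eE] ue by (auto simp: card_2_iff)
    have "y \<in> (adj E ^^ 1) `` {u}" "u \<in> (adj E ^^ 0) `` {u}" using eE e by (auto simp: adj_def)
    then show ?thesis using reach_B[of 1] reach_B[of 0] assms e by blast
  qed
  then have "{e \<in> F. u \<in> e} = {e \<in> E. u \<in> e}" by (auto simp: F_def)
  then have "card {e \<in> F. u \<in> e} = D" using reg assms by (simp add: regular_def)
  moreover have "(\<Sum>v\<in>graph_sphere F u i. restrict Y B v) = (\<Sum>v\<in>graph_sphere E u i. Y v)" if "i \<le> k" for i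
    using sub[OF that] sphere[OF that] by (intro sum.cong) auto
  ultimately show ?thesis
    by (simp add: local_field_def local_view_def Let_def flip: B_def F_def)
qed

text \<open>Weights extended by zero to all of \<open>V\<close>, which makes the fields linear forms
  in one common family of labels. Spheres are disjoint, so at most one summand is nonzero.\<close>

definition coeff :: "'v \<Rightarrow> 'v \<Rightarrow> real" where
  "coeff u v = (\<Sum>i\<le>k. if v \<in> graph_sphere E u i then decay D ^ i else 0)"

lemma sum_coeff:
  assumes "u \<in> V"
  shows "(\<Sum>v\<in>V. coeff u v * Y v) = (\<Sum>i\<le>k. decay D ^ i * (\<Sum>v\<in>graph_sphere E u i. Y v))"
proof -
  have "(\<Sum>v\<in>V. coeff u v * Y v) = (\<Sum>i\<le>k. \<Sum>v\<in>V. (if v \<in> graph_sphere E u i then decay D ^ i else 0) * Y v)"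
    unfolding coeff_def sum_distrib_right by (rule sum.swap)
  also have "\<dots> = (\<Sum>i\<le>k. \<Sum>v\<in>graph_sphere E u i. decay D ^ i * Y v)"
    using sphere_subset[OF assms] finite_V by (intro sum.cong refl sum.mono_neutral_cong_right) auto
  finally show ?thesis by (simp add: sum_distrib_left)
qed

lemma sum_coeff_coeff:
  assumes "u \<in> V"
  shows "(\<Sum>v\<in>V. coeff u v * coeff w v) =
    (\<Sum>i\<le>k. \<Sum>j\<le>k. decay D ^ (i + j) * card (graph_sphere E u i \<inter> graph_sphere E w j))"
proof -
  have inner: "(\<Sum>v\<in>graph_sphere E u i. coeff w v) = (\<Sum>j\<le>k. decay D ^ j * card (graph_sphere E u i \<inter> graph_sphere E w j))" for i
  proof -
    have "(\<Sum>v\<in>graph_sphere E u i. coeff w v) =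
      (\<Sum>j\<le>k. \<Sum>v\<in>graph_sphere E u i. if v \<in> graph_sphere E w j then decay D ^ j else 0)"
      unfolding coeff_def by (rule sum.swap)
    also have "\<dots> = (\<Sum>j\<le>k. decay D ^ j * card (graph_sphere E u i \<inter> graph_sphere E w j))"
      using finite_sphere[OF assms] by (simp add: sum.If_cases mult.commute)
    finally show ?thesis .
  qed
  show ?thesis
    unfolding sum_coeff[OF assms] inner by (simp add: sum_distrib_left power_add mult.assoc)
qed

text \<open>The squared decay cancels the branching number \<open>D - 1\<close>. The odd exponent
  covers \<open>D = 1\<close>, where \<open>decay D = 0\<close>; the even analogue with value
  \<open>1\<close> fails there for \<open>i >= 1\<close>.\<close>

lemma decay_power:
  assumes "D \<ge> 1"
  shows "decay D ^ (2 * i + 1) * real ((D - 1) ^ i) = decay D"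
proof (cases "D = 1")
  case False
  then have "(decay D)\<^sup>2 * (real D - 1) = 1"
    using assms by (simp add: decay_def power_divide)
  moreover have "real (D - 1) = real D - 1" using assms by (simp add: of_nat_diff)
  moreover have "decay D ^ (2 * i + 1) * real ((D - 1) ^ i) = decay D * ((decay D)\<^sup>2 * real (D - 1)) ^ i"
    by (simp add: power_mult power_mult_distrib)
  ultimately show ?thesis by simp
qed (simp add: decay_def)

text \<open>The root contributes \<open>1\<close> and each of the \<open>k\<close> further layers
  \<open>D * (decay D)\<^sup>2\<close>.\<close>

lemma variance_coeff:
  assumes "u \<in> V" "D \<ge> 1"
  shows "(\<Sum>v\<in>V. (coeff u v)\<^sup>2) = 1 + real k * real D * (decay D)\<^sup>2"
proof -
  have off: "graph_sphere E u i \<inter> graph_sphere E u j = (if j = i then graph_sphere E u i else {})" for i j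
    by (auto dest: sphere_disjoint)
  have "(\<Sum>v\<in>V. (coeff u v)\<^sup>2) = (\<Sum>i\<le>k. \<Sum>j\<le>k. if j = i then decay D ^ (i + i) * card (graph_sphere E u i) else 0)"
    unfolding power2_eq_square sum_coeff_coeff[OF assms(1)] off by (intro sum.cong) auto
  also have "\<dots> = (\<Sum>i\<le>k. decay D ^ (i + i) * card (graph_sphere E u i))"
    by simp
  also have "\<dots> = 1 + (\<Sum>i<k. decay D ^ (Suc i + Suc i) * card (graph_sphere E u (Suc i)))"
    unfolding sum.atMost_shift by (simp add: sphere_0)
  also have "(\<Sum>i<k. decay D ^ (Suc i + Suc i) * card (graph_sphere E u (Suc i))) = (\<Sum>i<k. real D * (decay D)\<^sup>2)"
  proof (rule sum.cong)
    fix i assume "i \<in> {..<k}"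
    then have "decay D ^ (Suc i + Suc i) * card (graph_sphere E u (Suc i)) =
      real D * decay D * (decay D ^ (2 * i + 1) * real ((D - 1) ^ i))"
      using card_sphere[OF assms(1), of i] by (simp add: mult_2 power_add)
    then show "decay D ^ (Suc i + Suc i) * card (graph_sphere E u (Suc i)) = real D * (decay D)\<^sup>2"
      unfolding decay_power[OF assms(2)] by (simp add: power2_eq_square)
  qed simp
  finally show ?thesis by simp
qed

end

lemma sum_adjacent:
  fixes g :: "nat \<Rightarrow> nat \<Rightarrow> 'a :: comm_monoid_add"
  assumes "\<And>i j. i \<le> k \<Longrightarrow> j \<le> k \<Longrightarrow> j \<noteq> Suc i \<Longrightarrow> i \<noteq> Suc j \<Longrightarrow> g i j = 0"
  shows "(\<Sum>i\<le>k. \<Sum>j\<le>k. g i j) = (\<Sum>i<k. g i (Suc i) + g (Suc i) i)"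
  using assms
proof (induction k)
  case (Suc k)
  have "(\<Sum>i\<le>k. g i (Suc k)) = (\<Sum>i\<in>{k}. g i (Suc k))" "(\<Sum>j\<le>k. g (Suc k) j) = (\<Sum>j\<in>{k}. g (Suc k) j)"
    by (intro sum.mono_neutral_right; auto intro!: Suc.prems)+
  moreover have "g (Suc k) (Suc k) = 0" by (rule Suc.prems) auto
  moreover have "(\<Sum>i\<le>k. \<Sum>j\<le>k. g i j) = (\<Sum>i<k. g i (Suc i) + g (Suc i) i)"
    by (rule Suc.IH) (auto intro: Suc.prems)
  ultimately show ?case by (simp add: sum.distrib add_ac)
qed simp

context high_girth_graph
begin

text \<open>No vertex is equally far from \<open>u\<close> and \<open>w\<close> within radius
  \<open>k\<close>, since the edge would then lie inside a sphere around it. The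
  \<open>2 * k\<close> blocks left, at distances \<open>i\<close> and \<open>i + 1\<close>,
  contribute \<open>decay D\<close> each.\<close>

lemma covariance_coeff:
  assumes uw: "(u, w) \<in> adj E" and "D \<ge> 1"
  shows "(\<Sum>v\<in>V. coeff u v * coeff w v) = 2 * real k * decay D"
proof -
  have u: "u \<in> V" using adj_in_V uw by blast
  have wu: "(w, u) \<in> adj E" using uw adj_sym by metis
  have "graph_sphere E u i \<inter> graph_sphere E w j = {}" if "i \<le> k" "j \<le> k" "j \<noteq> Suc i" "i \<noteq> Suc j" for i j
  proof (rule equals0I)
    fix x assume "x \<in> graph_sphere E u i \<inter> graph_sphere E w j"
    then have x: "u \<in> graph_sphere E x i" "w \<in> graph_sphere E x j"
      using sphere_sym[of x E] by auto
    from sphere_step[OF x(1) uw] obtain j' where "w \<in> graph_sphere E x j'" "j' \<le> Suc i" "i \<le> Suc j'" .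
    then have "i = j" using sphere_disjoint[OF x(2)] that by fastforce
    then show False using sphere_no_inner_edge[of i u x w] x uw that by blast
  qed
  then have "(\<Sum>v\<in>V. coeff u v * coeff w v) =
    (\<Sum>i<k. decay D ^ (i + Suc i) * card (graph_sphere E u i \<inter> graph_sphere E w (Suc i)) +
       decay D ^ (Suc i + i) * card (graph_sphere E u (Suc i) \<inter> graph_sphere E w i))"
    unfolding sum_coeff_coeff[OF u] by (intro sum_adjacent) simp
  also have "\<dots> = (\<Sum>i<k. 2 * decay D)"
  proof (rule sum.cong)
    fix i assume "i \<in> {..<k}"
    then have card: "card (graph_sphere E u i \<inter> graph_sphere E w (Suc i)) = (D - 1) ^ i"
      "card (graph_sphere E u (Suc i) \<inter> graph_sphere E w i) = (D - 1) ^ i"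
      using card_side[OF uw, of i] card_side[OF wu, of i] by (auto simp: Int_commute)
    have exp: "i + Suc i = 2 * i + 1" "Suc i + i = 2 * i + 1" by simp_all
    show "decay D ^ (i + Suc i) * card (graph_sphere E u i \<inter> graph_sphere E w (Suc i)) +
       decay D ^ (Suc i + i) * card (graph_sphere E u (Suc i) \<inter> graph_sphere E w i) = 2 * decay D"
      unfolding card exp decay_power[OF assms(2)] by simp
  qed simp
  finally show ?thesis by simp
qed

end

text \<open>With half-sum \<open>m\<close> and half-difference \<open>d\<close> of the angles,
  \<open>y - x = 2 * sin m * sin d\<close>. As \<open>y \<le> 0\<close> forces
  \<open>d \<le> pi / 4\<close>, both sines are at least \<open>d / 2\<close>, so
  \<open>y - x\<close> is at least \<open>d\<^sup>2 / 2\<close>.\<close>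

lemma arccos_diff_le_sqrt:
  fixes x y :: real
  assumes "-1 \<le> x" "x \<le> y" "y \<le> 0"
  shows "arccos x - arccos y \<le> sqrt (8 * (y - x))"
proof -
  define d where "d = (arccos x - arccos y) / 2"
  define m where "m = (arccos x + arccos y) / 2"
  have "arccos y \<le> arccos x" using assms by (intro arccos_le_arccos) auto
  moreover have "arccos x \<le> pi" using assms by (intro arccos_ubound) auto
  moreover have "pi / 2 \<le> arccos y"
    using arccos_le_arccos[of y 0] assms by simp
  ultimately have d: "0 \<le> d" "d \<le> pi / 4" "pi / 2 \<le> m" "m \<le> pi - d"
    by (simp_all add: d_def m_def field_simps)
  have sin_d: "d / 2 \<le> sin d"
  proof (cases "d = 0")
    case False
    then have "\<exists>z>0. z < d \<and> sin d - sin 0 = (d - 0) * cos z"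
      using d by (intro MVT2) (auto intro!: derivative_eq_intros)
    then obtain z where z: "0 < z" "z < d" "sin d = d * cos z" by auto
    have "cos (pi / 3) \<le> cos z" using z d by (intro cos_monotone_0_pi_le) auto
    then have "d * (1 / 2) \<le> d * cos z" using d by (intro mult_left_mono) (auto simp: cos_60)
    then show ?thesis using z by simp
  qed simp
  have "sin d \<le> sin m"
  proof -
    have "sin d \<le> sin (pi - m)" using d by (intro sin_monotone_2pi_le) auto
    then show ?thesis by simp
  qed
  then have "(d / 2) * (d / 2) \<le> sin m * sin d"
    using sin_d d by (intro mult_mono) auto
  also have "sin m * sin d = (y - x) / 2"
    using cos_diff_cos[of "arccos y" "arccos x"] assms
    by (simp add: d_def m_def add.commute)
  finally have "(2 * d)\<^sup>2 \<le> 8 * (y - x)" by (simp add: power2_eq_square)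
  then have "2 * d \<le> sqrt (8 * (y - x))" by (rule real_le_rsqrt)
  then show ?thesis by (simp add: d_def)
qed

text \<open>With \<open>r = sqrt (D - 1)\<close>, the correlation \<open>- 2 * k * r / (r\<^sup>2 + k * (r\<^sup>2 + 1))\<close> exceeds its
  limit \<open>- 2 * r / (r\<^sup>2 + 1)\<close> by at most \<open>1 / k\<close>.\<close>

lemma correlation_bound:
  fixes D k :: nat
  assumes "D \<ge> 1" "k \<ge> 1"
  defines "v \<equiv> 1 + real k * real D * (decay D)\<^sup>2"
  obtains \<phi> where "v > 0" "2 * real k * decay D = v * cos \<phi>" "0 \<le> \<phi>" "\<phi> < pi"
    "\<phi> / pi \<ge> 1 / pi * arccos (- (2 * sqrt (real D - 1) / real D)) - 1 / sqrt (real k)"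
proof -
  define r where "r = sqrt (real D - 1)"
  define x where "x = - (2 * r / real D)"
  define y where "y = 2 * real k * decay D / v"
  have v: "v > 0" unfolding v_def by (intro add_pos_nonneg) auto
  have D: "real D = r\<^sup>2 + 1" and r: "r \<ge> 0" using assms by (auto simp: r_def)
  have "2 * r \<le> r\<^sup>2 + 1" using sum_squares_bound[of r 1] by simp
  then have x: "-1 \<le> x" unfolding x_def D by (simp add: add_nonneg_pos divide_le_eq)
  have y: "x \<le> y \<and> y - x \<le> 1 / real k \<and> y \<le> 0 \<and> -1 < y"
  proof (cases "r = 0")
    \<comment> \<open>The case \<open>D = 1\<close>: the decay is \<open>0\<close> by division by
      zero, and the correlation and its limit both vanish.\<close>
    case True
    then have "x = 0" "y = 0" by (auto simp: x_def y_def decay_def r_def)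
    then show "x \<le> y \<and> y - x \<le> 1 / real k \<and> y \<le> 0 \<and> -1 < y" by simp
  next
    case False
    define K where "K = real k"
    have K: "K \<ge> 1" using assms by (simp add: K_def)
    have "r > 0" using False r by simp
    \<comment> \<open>The variance with its denominator cleared: \<open>decay D = - 1 / r\<close>
      gives \<open>v = W / r\<^sup>2\<close>.\<close>
    define W where "W = r\<^sup>2 + K * (r\<^sup>2 + 1)"
    have W: "W > 0" unfolding W_def using K \<open>r > 0\<close> by (intro add_pos_pos mult_pos_pos) auto
    have vW: "v = W / r\<^sup>2"
      using \<open>r > 0\<close> unfolding v_def decay_def r_def[symmetric] D W_def K_def
      by (simp add: field_simps power_divide)
    then have yW: "y = - (2 * K * r / W)"
      using \<open>r > 0\<close> W unfolding y_def vW decay_def r_def[symmetric] K_def[symmetric]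
      by (simp add: power2_eq_square)
    have yx: "y - x = (2 * r / (r\<^sup>2 + 1)) * (r\<^sup>2 / W)"
    proof -
      have p: "r\<^sup>2 + 1 > 0" by (simp add: add_nonneg_pos)
      have "y - x = (2 * r * W - 2 * K * r * (r\<^sup>2 + 1)) / ((r\<^sup>2 + 1) * W)"
        unfolding yW x_def D using p W by (simp add: diff_frac_eq mult.commute)
      also have "2 * r * W - 2 * K * r * (r\<^sup>2 + 1) = 2 * r * r\<^sup>2"
        by (simp add: W_def algebra_simps)
      finally show ?thesis by simp
    qed
    have f: "0 \<le> 2 * r / (r\<^sup>2 + 1)" "2 * r / (r\<^sup>2 + 1) \<le> 1" "0 \<le> r\<^sup>2 / W"
      using r x W unfolding x_def D by simp_all
    have f': "r\<^sup>2 / W \<le> 1 / K"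
      using K W by (simp add: divide_le_eq le_divide_eq W_def algebra_simps)
    have "0 \<le> y - x" unfolding yx using f by (intro mult_nonneg_nonneg)
    moreover have "y - x \<le> 1 * (1 / K)" unfolding yx using f f' by (intro mult_mono) auto
    moreover have "y \<le> 0" using W K r unfolding yW by simp
    \<comment> \<open>Strict even for \<open>D = 2\<close>, where \<open>x = -1\<close>: the root
      layer adds the \<open>r\<^sup>2\<close> in \<open>W\<close>. This yields
      \<open>\<phi> < pi\<close>.\<close>
    moreover have "-1 < y"
    proof -
      have "K * (2 * r) \<le> K * (r\<^sup>2 + 1)" using K \<open>2 * r \<le> r\<^sup>2 + 1\<close> by (intro mult_left_mono) auto
      also have "\<dots> < W" using \<open>r > 0\<close> by (simp add: W_def)
      finally show ?thesis using W unfolding yW by (simp add: divide_less_eq mult_ac)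
    qed
    ultimately show "x \<le> y \<and> y - x \<le> 1 / real k \<and> y \<le> 0 \<and> -1 < y" by (simp add: K_def)
  qed
  show ?thesis
  proof (rule that[of "arccos y"])
    show "v > 0" by (fact v)
    show "2 * real k * decay D = v * cos (arccos y)"
      using y v by (simp add: cos_arccos) (simp add: y_def)
    show "0 \<le> arccos y" using y by (intro arccos_lbound) auto
    show "arccos y < pi" using y arccos_less_arccos[of "-1" y] by simp
    have "arccos x - arccos y \<le> sqrt (8 * (y - x))" using x y by (intro arccos_diff_le_sqrt) auto
    \<comment> \<open>Rounding 8 up to 9 gives the root 3, which is below \<open>pi\<close>; after
      division by \<open>pi\<close> the constant is 1.\<close>
    also have "\<dots> \<le> sqrt (9 * (1 / real k))" using y by (intro real_sqrt_le_mono) auto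
    also have "\<dots> = 3 / sqrt (real k)" by (simp add: real_sqrt_mult real_sqrt_divide)
    also have "\<dots> \<le> pi / sqrt (real k)" using pi_gt3 by (intro divide_right_mono) auto
    finally have "(arccos x - arccos y) / pi \<le> 1 / sqrt (real k)"
      by (simp add: divide_le_eq)
    then show "arccos y / pi \<ge> 1 / pi * arccos (- (2 * sqrt (real D - 1) / real D)) - 1 / sqrt (real k)"
      by (simp add: diff_divide_distrib flip: r_def x_def)
  qed
qed

text \<open>With \<open>sin t = 1 / sqrt D\<close> the limit correlation is
  \<open>- sin (2 * t)\<close>, whose \<open>arccos\<close> is \<open>pi / 2 + 2 * t\<close>; the
  claim is then \<open>sin t < t\<close>. It fails for \<open>D = 1\<close>, where the left side is
  \<open>1 / 2\<close>.\<close>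

lemma arccos_limit_gt:
  fixes D :: nat
  assumes "D \<ge> 2"
  shows "1 / pi * arccos (- (2 * sqrt (real D - 1) / real D)) > 1 / 2 + 2 / (pi * sqrt (real D))"
proof -
  define s where "s = 1 / sqrt (real D)"
  define t where "t = arcsin s"
  have D: "real D \<ge> 2" using assms by simp
  have s: "0 < s" "s \<le> 1" and s2: "s\<^sup>2 = 1 / real D" using D by (auto simp: s_def power_divide)
  have sin_t: "sin t = s" using s by (simp add: t_def)
  have t: "0 < t" "t \<le> pi / 2"
    using arcsin_less_arcsin[of 0 s] arcsin_ubound[of s] s by (auto simp: t_def)
  have cos_t: "cos t = sqrt ((real D - 1) / real D)"
    using s s2 D unfolding t_def by (simp add: cos_arcsin diff_divide_distrib)
  \<comment> \<open>Keeps \<open>pi / 2 + 2 * t\<close> within the range of \<open>arccos\<close>.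
    It uses \<open>D >= 2\<close> through \<open>cos (2 * t) = 1 - 2 / D\<close>.\<close>
  have "t \<le> pi / 4"
  proof (rule ccontr)
    assume "\<not> t \<le> pi / 4"
    then have "cos (2 * t) < 0" using t by (intro cos_lt_zero_pi) auto
    moreover have "cos (2 * t) = 1 - 2 / real D"
      using cos_double_sin[of t] by (simp add: sin_t s2)
    moreover have "2 / real D \<le> 1" using D by simp
    ultimately show False by linarith
  qed
  have "s < t"
  proof -
    have "\<exists>z>0. z < t \<and> sin t - sin 0 = (t - 0) * cos z"
      using t by (intro MVT2) (auto intro!: derivative_eq_intros)
    then obtain z where z: "0 < z" "z < t" "s = t * cos z" by (auto simp: sin_t)
    have "cos z < cos 0" using z t by (intro cos_monotone_0_pi) auto
    then show ?thesis using z t by simp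
  qed
  have "2 * sqrt (real D - 1) / real D = 2 * s * sqrt ((real D - 1) / real D)"
    using D by (simp add: s_def real_sqrt_divide)
  also have "\<dots> = sin (2 * t)" by (simp add: sin_double sin_t cos_t)
  also have "\<dots> = - cos (pi / 2 + 2 * t)" by (simp add: cos_add)
  finally have "arccos (- (2 * sqrt (real D - 1) / real D)) = pi / 2 + 2 * t"
    using t \<open>t \<le> pi / 4\<close> by (simp add: arccos_cos)
  moreover have "1 / pi * (pi / 2 + 2 * t) = 1 / 2 + 2 * t / pi" by (simp add: field_simps)
  moreover have "2 / (pi * sqrt (real D)) = 2 * s / pi" by (simp add: s_def)
  ultimately show ?thesis using \<open>s < t\<close> by (simp add: divide_strict_right_mono)
qed

section \<open>Averaging over the edges\<close>

context high_girth_graph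
begin

lemma local_output_sign_rule:
  assumes "u \<in> V" "k \<ge> 1"
  shows "local_output k (sign_rule k) E Y u = (if (\<Sum>v\<in>V. coeff u v * Y v) > 0 then 1 else - 1)"
  using assms by (simp add: local_output_def sign_rule_def local_field_local_view sum_coeff)

text \<open>Each single edge is cut with at least the stated probability, and linearity of
  expectation averages these probabilities.\<close>

lemma expected_cut_fraction_sign_rule:
  assumes "V \<noteq> {}" "D \<ge> 1" "k \<ge> 1"
  shows "expected_cut_fraction k gaussian (sign_rule k) V E
    \<ge> 1 / pi * arccos (- (2 * sqrt (real D - 1) / real D)) - 1 / sqrt (real k)" (is "_ \<ge> ?b")
proof -
  define P where "P = PiM V (\<lambda>_. gaussian)"
  interpret P: prob_space P unfolding P_def by (intro prob_space_PiM gaussian.prob_space_axioms)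
  define X where "X Y u = local_output k (sign_rule k) E Y u" for Y :: "'v \<Rightarrow> real" and u
  define A where "A e = {Y \<in> space P. \<exists>i j. e = {i, j} \<and> X Y i \<noteq> X Y j}" for e
  \<comment> \<open>The uniform distribution on the edges is meaningful only for a nonempty edge
    set.\<close>
  have "E \<noteq> {}"
  proof
    assume "E = {}"
    with reg assms show False by (auto simp: regular_def)
  qed
  have A: "A e \<in> sets P \<and> ?b \<le> measure P (A e)" if eE: "e \<in> E" for e
  proof -
    obtain u w where e: "e = {u, w}" using edge[OF eE] by (auto simp: card_2_iff)
    then have uw: "(u, w) \<in> adj E" using eE by (simp add: adj_def)
    then have V: "u \<in> V" "w \<in> V" using adj_in_V by blast+
    have A: "A e = {Y \<in> space P. ((\<Sum>v\<in>V. coeff u v * Y v) > 0) \<noteq> ((\<Sum>v\<in>V. coeff w v * Y v) > 0)}"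
    proof -
      have "(\<exists>i j. {u, w} = {i, j} \<and> X Y i \<noteq> X Y j) \<longleftrightarrow> X Y u \<noteq> X Y w" for Y
        by (metis doubleton_eq_iff)
      then show ?thesis
        using V assms by (auto simp: A_def e X_def local_output_sign_rule)
    qed
    obtain \<phi> where "1 + real k * real D * (decay D)\<^sup>2 > 0"
      "2 * real k * decay D = (1 + real k * real D * (decay D)\<^sup>2) * cos \<phi>" "0 \<le> \<phi>" "\<phi> < pi" "\<phi> / pi \<ge> ?b"
      using correlation_bound[OF assms(2,3)] .
    then have "?b \<le> measure P (A e)"
      using gaussian_sign_disagreement[OF finite_V variance_coeff[OF V(1) assms(2)] variance_coeff[OF V(2) assms(2)], of \<phi>]
        covariance_coeff[OF uw assms(2)]
      unfolding A P_def by linarith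
    moreover have "A e \<in> sets P" unfolding A P_def by measurable
    ultimately show ?thesis by simp
  qed
  have "expected_cut_fraction k gaussian (sign_rule k) V E = (\<integral>Y. cut_fraction E (X Y) \<partial>P)"
    by (simp add: expected_cut_fraction_def P_def X_def[abs_def])
  also have "\<dots> = (\<integral>Y. (\<Sum>e\<in>E. indicator (A e) Y) / card E \<partial>P)"
  proof (rule Bochner_Integration.integral_cong)
    fix Y assume "Y \<in> space P"
    define S where "S = {e. \<exists>i j. e = {i, j} \<and> X Y i \<noteq> X Y j}"
    have "cut_fraction E (X Y) = card (E \<inter> S) / card E"
      unfolding cut_fraction_def S_def
      by (rule measure_pmf_of_set) (use finite_E \<open>E \<noteq> {}\<close> in auto)
    also have "real (card (E \<inter> S)) = (\<Sum>e\<in>E. indicator (A e) Y)"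
      using finite_E \<open>Y \<in> space P\<close>
      by (simp add: indicator_def A_def S_def sum.If_cases Int_def)
    finally show "cut_fraction E (X Y) = (\<Sum>e\<in>E. indicator (A e) Y) / card E" .
  qed simp
  also have "\<dots> = (\<Sum>e\<in>E. measure P (A e)) / card E"
  proof -
    have "integrable P (indicator (A e) :: _ \<Rightarrow> real)" if "e \<in> E" for e
      using A[OF that] by (intro integrable_real_indicator) (auto simp: P.emeasure_eq_measure)
    moreover have "A e \<inter> space P = A e" for e by (auto simp: A_def)
    ultimately show ?thesis by simp
  qed
  also have "\<dots> \<ge> (\<Sum>e\<in>E. ?b) / card E"
    using A by (intro divide_right_mono sum_mono) auto
  also have "(\<Sum>e\<in>E. ?b) / card E = ?b"
    using finite_E \<open>E \<noteq> {}\<close> by simp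
  finally show ?thesis .
qed

end

text \<open>The rule is chosen after \<open>k\<close> but before \<open>D\<close> and the graph.
  Radius 0 is excluded because \<open>C / sqrt 0\<close> is \<open>0\<close>, which would claim no
  loss at all.\<close>

theorem theorem4:
  "\<exists>C::real. C > 0 \<and> (\<forall>k::nat. k \<ge> 1 \<longrightarrow>
     (\<exists>(M :: real measure) (f :: (nat, real) labeled_graph \<Rightarrow> int). local_algorithm M f \<and>
       (\<forall>(D::nat) (n::nat) (V :: nat set) (E :: nat set set).
          simple_graph V E \<and> card V = n \<and> n \<ge> 1 \<and> D \<ge> 1 \<and> regular V E D \<and>
          girth E > enat (2 * k + 1) \<longrightarrow>
            expected_cut_fraction k M f V E
              \<ge> 1 / pi * arccos (- (2 * sqrt (real D - 1) / real D)) - C / sqrt (real k) \<and>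
            (D \<ge> 2 \<longrightarrow>
              1 / pi * arccos (- (2 * sqrt (real D - 1) / real D)) - C / sqrt (real k)
                > 1 / 2 + 2 / (pi * sqrt (real D)) - C / sqrt (real k)))))"
proof (rule exI[of _ 1], intro conjI allI impI)
  fix k :: nat assume k: "1 \<le> k"
  show "\<exists>(M :: real measure) (f :: (nat, real) labeled_graph \<Rightarrow> int). local_algorithm M f \<and>
       (\<forall>(D::nat) (n::nat) (V :: nat set) (E :: nat set set).
          simple_graph V E \<and> card V = n \<and> n \<ge> 1 \<and> D \<ge> 1 \<and> regular V E D \<and>
          girth E > enat (2 * k + 1) \<longrightarrow>
            expected_cut_fraction k M f V E
              \<ge> 1 / pi * arccos (- (2 * sqrt (real D - 1) / real D)) - 1 / sqrt (real k) \<and>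
            (D \<ge> 2 \<longrightarrow>
              1 / pi * arccos (- (2 * sqrt (real D - 1) / real D)) - 1 / sqrt (real k)
                > 1 / 2 + 2 / (pi * sqrt (real D)) - 1 / sqrt (real k)))"
  proof (intro exI conjI allI impI)
    show "local_algorithm gaussian (sign_rule k)" by (rule local_algorithm_sign_rule)
    fix D n :: nat and V :: "nat set" and E
    assume a: "simple_graph V E \<and> card V = n \<and> n \<ge> 1 \<and> D \<ge> 1 \<and> regular V E D \<and> girth E > enat (2 * k + 1)"
    then interpret high_girth_graph V E D k by unfold_locales auto
    show "expected_cut_fraction k gaussian (sign_rule k) V E
      \<ge> 1 / pi * arccos (- (2 * sqrt (real D - 1) / real D)) - 1 / sqrt (real k)"
      by (rule expected_cut_fraction_sign_rule) (use a k in auto)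
    assume "D \<ge> 2"
    then show "1 / pi * arccos (- (2 * sqrt (real D - 1) / real D)) - 1 / sqrt (real k)
      > 1 / 2 + 2 / (pi * sqrt (real D)) - 1 / sqrt (real k)"
      using arccos_limit_gt[of D] by linarith
  qed
qed simp

end
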